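(* Let $n\ge 0$ be an integer. The class $\mathcal{M}_n$ consists precisely of all wavelets $\psi\in L^2(\mathbb{R})$ such that the support of $\hat\psi$ is not partially self-similar with respect to any odd multiple of $2^k\pi$ for $k=1,2,\ldots,n$, but is partially self-similar with respect to some odd multiple of $2^{n+1}\pi$.
   Context: On $L^2(\mathbb{R})$ define the unitary operators $Df(x)=\sqrt{2}\,f(2x)$, $T_\alpha f(x)=f(x-\alpha)$ for $\alpha\in\mathbb{R}$, and $T=T_1$. A function $\psi\in L^2(\mathbb{R})$ is a wavelet if $\{D^nT^l\psi: n,l\in\mathbb{Z}\}$ is an orthonormal basis of $L^2(\mathbb{R})$. Its core space is $V_0=\overline{\operatorname{span}}\{D^nT^l\psi: n<0,\ l\in\mathbb{Z}\}$. For an integer $n\ge 0$ let $\mathcal{G}_n=\{T_{m/2^n}: m\in\mathbb{Z}\}$, let $\mathcal{L}_n$ be the collection of all wavelets whose core space is invariant under $\mathcal{G}_n$ (i.e. mapped into itself by every element of $\mathcal{G}_n$), and let $\mathcal{M}_n=\mathcal{L}_n\setminus\mathcal{L}_{n+1}$. The Fourier transform is the unitary one, $\hat f(\xi)=\frac{1}{\sqrt{2\pi}}\int f(x)e^{-ix\xi}\,dx$. The support of $\hat\psi$ is the measurable set $\{\xi:\hat\psi(\xi)\neq 0\}$, defined up to Lebesgue null sets (not the closed support). A measurable set $E\subset\mathbb{R}$ is partially self-similar with respect to $\alpha\in\mathbb{R}$ if there is a measurable set $F$ of non-zero Lebesgue measure such that both $F$ and $F+\alpha$ are subsets of $E$.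 An odd multiple of $c$ is a number $kc$ with $k$ an odd integer (positive or negative). *)

theory Defs
  imports "HOL-Analysis.Analysis" "HOL-Library.Function_Algebras"
begin

text \<open>
  Elements of $L^2(\mathbb{R})$ are represented by Lebesgue measurable functions. Every notion
  below is invariant under changing representatives on a null set.
\<close>

definition L2 :: "(real \<Rightarrow> complex) set" where
  "L2 = {f. f \<in> borel_measurable lebesgue \<and> integrable lebesgue (\<lambda>x. (cmod (f x))\<^sup>2)}"

definition L2_inner :: "(real \<Rightarrow> complex) \<Rightarrow> (real \<Rightarrow> complex) \<Rightarrow> complex" where
  "L2_inner f g = (LINT x|lebesgue. f x * cnj (g x))"

definition L2_norm :: "(real \<Rightarrow> complex) \<Rightarrow> real" where
  "L2_norm f = sqrt (LINT x|lebesgue. (cmod (f x))\<^sup>2)"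

definition L2_tendsto :: "('i \<Rightarrow> real \<Rightarrow> complex) \<Rightarrow> (real \<Rightarrow> complex) \<Rightarrow> 'i filter \<Rightarrow> bool" where
  "L2_tendsto s f F \<longleftrightarrow>
     (\<forall>i. s i \<in> L2) \<and> f \<in> L2 \<and> ((\<lambda>i. L2_norm (\<lambda>x. s i x - f x)) \<longlongrightarrow> 0) F"

definition cscale :: "complex \<Rightarrow> (real \<Rightarrow> complex) \<Rightarrow> real \<Rightarrow> complex" where
  "cscale c f = (\<lambda>x. c * f x)"

interpretation cfun: vector_space cscale
  by standard (auto simp: cscale_def fun_eq_iff algebra_simps)

definition closed_span :: "(real \<Rightarrow> complex) set \<Rightarrow> (real \<Rightarrow> complex) set" where
  "closed_span S = {f. \<exists>s::nat \<Rightarrow> real \<Rightarrow> complex.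
     (\<forall>i. s i \<in> cfun.span S) \<and> L2_tendsto s f sequentially}"

definition dilation :: "(real \<Rightarrow> complex) \<Rightarrow> real \<Rightarrow> complex" where
  "dilation f = (\<lambda>x. complex_of_real (sqrt 2) * f (2 * x))"

definition translation :: "real \<Rightarrow> (real \<Rightarrow> complex) \<Rightarrow> real \<Rightarrow> complex" where
  "translation \<alpha> f = (\<lambda>x. f (x - \<alpha>))"

text \<open>Integer powers of a bijective operator.\<close>

definition op_powi :: "('a \<Rightarrow> 'a) \<Rightarrow> int \<Rightarrow> 'a \<Rightarrow> 'a" where
  "op_powi U n = (if 0 \<le> n then U ^^ nat n else inv U ^^ nat (- n))"

lemma inv_dilation: "inv dilation f = (\<lambda>x. f (x / 2) / complex_of_real (sqrt 2))"
proof (rule inv_f_eq)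
  show "inj dilation"
  proof (rule injI, rule ext)
    fix f g :: "real \<Rightarrow> complex" and x
    assume "dilation f = dilation g"
    then have "dilation f (x / 2) = dilation g (x / 2)" by simp
    then show "f x = g x" by (simp add: dilation_def)
  qed
qed (simp add: dilation_def)

lemma inv_translation: "inv (translation \<alpha>) = translation (- \<alpha>)"
  by (rule inv_equality) (simp_all add: translation_def)

lemma op_powi_dilation:
  "op_powi dilation n f = (\<lambda>x. complex_of_real (sqrt 2 powi n) * f (2 powi n * x))"
proof -
  have 1: "(dilation ^^ k) f = (\<lambda>x. complex_of_real (sqrt 2 ^ k) * f (2 ^ k * x))" for k
    by (induction k) (auto simp: dilation_def fun_eq_iff mult_ac)
  have 2: "(inv dilation ^^ k) f = (\<lambda>x. f (x / 2 ^ k) / complex_of_real (sqrt 2 ^ k))" for k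
    by (induction k) (auto simp: inv_dilation fun_eq_iff mult_ac)
  show ?thesis
    by (auto simp: op_powi_def 1 2 power_int_def fun_eq_iff field_simps)
qed

lemma op_powi_translation: "op_powi (translation 1) l = translation (of_int l)"
proof -
  have "(translation a ^^ k) f = translation (of_nat k * a) f" for a k f
    by (induction k) (auto simp: translation_def fun_eq_iff algebra_simps)
  then show ?thesis
    by (auto simp: op_powi_def inv_translation fun_eq_iff)
qed

definition affine_system :: "(real \<Rightarrow> complex) \<Rightarrow> int \<Rightarrow> int \<Rightarrow> real \<Rightarrow> complex" where
  "affine_system \<psi> n l = op_powi dilation n (op_powi (translation 1) l \<psi>)"

definition wavelet :: "(real \<Rightarrow> complex) \<Rightarrow> bool" where
  "wavelet \<psi> \<longleftrightarrow> \<psi> \<in> L2 \<and>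
     (\<forall>n l n' l'. L2_inner (affine_system \<psi> n l) (affine_system \<psi> n' l') =
        (if n = n' \<and> l = l' then 1 else 0)) \<and>
     closed_span {affine_system \<psi> n l | n l. True} = L2"

definition core_space :: "(real \<Rightarrow> complex) \<Rightarrow> (real \<Rightarrow> complex) set" where
  "core_space \<psi> = closed_span {affine_system \<psi> n l | n l. n < 0}"

definition translation_group :: "nat \<Rightarrow> ((real \<Rightarrow> complex) \<Rightarrow> real \<Rightarrow> complex) set" where
  "translation_group n = {translation (of_int m / 2 ^ n) | m :: int. True}"

definition wavelet_class_L :: "nat \<Rightarrow> (real \<Rightarrow> complex) set" where
  "wavelet_class_L n =
     {\<psi>. wavelet \<psi> \<and> (\<forall>U \<in> translation_group n. U ` core_space \<psi> \<subseteq> core_space \<psi>)}"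

definition wavelet_class_M :: "nat \<Rightarrow> (real \<Rightarrow> complex) set" where
  "wavelet_class_M n = wavelet_class_L n - wavelet_class_L (Suc n)"

text \<open>
  The unitary Fourier transform on $L^2(\mathbb{R})$ is the $L^2$-limit of the Fourier integrals
  over $[-R, R]$. The limit exists by Plancherel's theorem and is unique up to null sets; the
  choice operator only selects a representative.
\<close>

definition truncated_fourier :: "(real \<Rightarrow> complex) \<Rightarrow> real \<Rightarrow> real \<Rightarrow> complex" where
  "truncated_fourier f R \<xi> = complex_of_real (1 / sqrt (2 * pi)) *
     (LINT x:{-R..R}|lebesgue. f x * exp (- (\<i> * complex_of_real (x * \<xi>))))"

definition fourier :: "(real \<Rightarrow> complex) \<Rightarrow> real \<Rightarrow> complex" where
  "fourier f = (SOME g. L2_tendsto (truncated_fourier f) g at_top)"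

definition fourier_support :: "(real \<Rightarrow> complex) \<Rightarrow> real set" where
  "fourier_support f = {\<xi>. fourier f \<xi> \<noteq> 0}"

definition partially_self_similar :: "real set \<Rightarrow> real \<Rightarrow> bool" where
  "partially_self_similar E \<alpha> \<longleftrightarrow>
     (\<exists>F \<in> sets lebesgue. emeasure lebesgue F \<noteq> 0 \<and> F \<subseteq> E \<and> (\<lambda>x. x + \<alpha>) ` F \<subseteq> E)"

definition odd_multiple :: "real \<Rightarrow> real \<Rightarrow> bool" where
  "odd_multiple c \<alpha> \<longleftrightarrow> (\<exists>k::int. odd k \<and> \<alpha> = of_int k * c)"

end

theory Submission imports Defs begin

text \<open>
  Let $W_0$ be the closed span of the integer shifts of $\psi$. Comparing scales inside the
  orthonormal system shows that the core space is invariant under $\mathcal{G}_n$ iff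
  $T_\beta\psi \in W_0$ for all $\beta \in 2^{-n}\mathbb{Z}$. On the Fourier side $W_0$ consists of
  multiples of $\hat\psi$ by $2\pi$-periodic functions, so the condition says that
  $e^{-i\beta\xi}$ agrees on the support of $\hat\psi$ with a $2\pi$-periodic function, i.e. that
  two points of the support differing by $2\pi K$ always satisfy $2^n \mid K$, up to null sets.
  The integers $K$ not divisible by $2^n$ give exactly the odd multiples of $2^k\pi$ with
  $1 \le k \le n$.

  Plancherel's theorem is obtained from Parseval's identity on $[-R, R]$: integrating it over the
  modulations $e^{-ix\eta}$ with $0 \le \eta < \pi/R$ gives the isometry for functions supported in
  $[-R, R]$.
\<close>

section \<open>The space $L^2$\<close>

text \<open>Both approximation theorems on the Fourier side are instances of one fact: Laurent
  polynomials are dense in L2 of every finite Borel measure on the unit circle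
  (\<open>laurent_dense\<close>). Pushing Lebesgue measure on [-R, R] to the circle gives
  completeness of the Fourier modes, hence Parseval. Pushing |psi-hat|^2 dxi forward along xi ->
  e^{-i xi} turns approximation of a translate of \<psi> by its integer shifts into approximation by
  Laurent polynomials, with no division by the periodization of |psi-hat|^2. Orthonormality of the
  system is spent on the comparison of scales; the Fourier arguments are about a general \<psi> in
  L2. Since \<open>fourier\<close> is a chosen L2 limit, its existence must be settled first; the
  transform then enters through \<open>fourier_L2\<close> and the norm identity
  \<open>fourier_isometry\<close>. The construction behind the sufficiency of the support condition
  is a Borel multiplier: e^{-i \<beta> xi} has period 2 pi 2^n, so after deleting a null set from
  the support it can be cut off to a set of that period, and summing its 2^n translates by multiples
  of 2 pi gives period 2 pi without changing it on the support.\<close>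

lemma cmod_add_sq_le: "(cmod (a + b))\<^sup>2 \<le> 2 * (cmod a)\<^sup>2 + 2 * (cmod b)\<^sup>2"
proof -
  have "(cmod (a + b))\<^sup>2 \<le> (cmod a + cmod b)\<^sup>2"
    by (intro power_mono norm_triangle_ineq) auto
  also have "\<dots> \<le> 2 * (cmod a)\<^sup>2 + 2 * (cmod b)\<^sup>2"
    using sum_squares_bound[of "cmod a" "cmod b"] by (simp add: power2_sum)
  finally show ?thesis .
qed

lemma L2_measurable: "f \<in> L2 \<Longrightarrow> f \<in> borel_measurable lebesgue"
  by (simp add: L2_def)

lemma L2_integrable: "f \<in> L2 \<Longrightarrow> integrable lebesgue (\<lambda>x. (cmod (f x))\<^sup>2)"
  by (simp add: L2_def)

lemma L2_iff_nn_integral: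
  "f \<in> L2 \<longleftrightarrow> f \<in> borel_measurable lebesgue \<and> (\<integral>\<^sup>+x. ennreal ((cmod (f x))\<^sup>2) \<partial>lebesgue) < \<infinity>"
  unfolding L2_def by (auto simp: integrable_iff_bounded)

lemma L2_bound:
  assumes "g \<in> L2" "f \<in> borel_measurable lebesgue" "\<And>x. cmod (f x) \<le> C * cmod (g x)"
  shows "f \<in> L2"
proof -
  have "integrable lebesgue (\<lambda>x. (cmod (f x))\<^sup>2)"
  proof (rule Bochner_Integration.integrable_bound)
    show "integrable lebesgue (\<lambda>x. C\<^sup>2 * (cmod (g x))\<^sup>2)"
      using L2_integrable[OF assms(1)] by simp
    show "(\<lambda>x. (cmod (f x))\<^sup>2) \<in> borel_measurable lebesgue" using assms(2) by measurable
    show "AE x in lebesgue. norm ((cmod (f x))\<^sup>2) \<le> norm (C\<^sup>2 * (cmod (g x))\<^sup>2)"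
      using power_mono[OF assms(3), of _ 2] by (auto simp: power_mult_distrib)
  qed
  then show ?thesis using assms(2) by (simp add: L2_def)
qed

lemma L2_zero: "0 \<in> L2" "(\<lambda>x. 0) \<in> L2"
  by (auto simp: L2_def zero_fun_def)

lemma L2_add:
  assumes "f \<in> L2" "g \<in> L2" shows "(\<lambda>x. f x + g x) \<in> L2"
proof -
  note [measurable] = assms[THEN L2_measurable]
  have "integrable lebesgue (\<lambda>x. (cmod (f x + g x))\<^sup>2)"
  proof (rule Bochner_Integration.integrable_bound)
    show "integrable lebesgue (\<lambda>x. 2 * (cmod (f x))\<^sup>2 + 2 * (cmod (g x))\<^sup>2)"
      using assms[THEN L2_integrable] by simp
    show "AE x in lebesgue. norm ((cmod (f x + g x))\<^sup>2) \<le> norm (2 * (cmod (f x))\<^sup>2 + 2 * (cmod (g x))\<^sup>2)"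
      using cmod_add_sq_le by auto
  qed measurable
  then show ?thesis by (simp add: L2_def)
qed

lemma L2_mult_bounded:
  assumes "f \<in> L2" "m \<in> borel_measurable lebesgue" "\<And>x. cmod (m x) \<le> C"
  shows "(\<lambda>x. m x * f x) \<in> L2"
  using assms(2) L2_measurable[OF assms(1)]
  by (intro L2_bound[OF assms(1), of _ C]) (auto simp: norm_mult intro: mult_right_mono assms(3))

lemma L2_scale: "f \<in> L2 \<Longrightarrow> (\<lambda>x. c * f x) \<in> L2"
  by (rule L2_mult_bounded[where C = "cmod c"]) auto

lemma L2_diff:
  assumes "f \<in> L2" "g \<in> L2" shows "(\<lambda>x. f x - g x) \<in> L2"
  using L2_add[OF assms(1) L2_scale[OF assms(2), of "-1"]] by simp

lemma L2_sum: "(\<And>i. i \<in> I \<Longrightarrow> f i \<in> L2) \<Longrightarrow> (\<lambda>x. \<Sum>i\<in>I. f i x) \<in> L2"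
  by (induction I rule: infinite_finite_induct) (auto intro: L2_zero L2_add)

lemma L2_inner_integrable:
  assumes "f \<in> L2" "g \<in> L2" shows "integrable lebesgue (\<lambda>x. f x * cnj (g x))"
proof (rule Bochner_Integration.integrable_bound)
  note [measurable] = assms[THEN L2_measurable]
  show "integrable lebesgue (\<lambda>x. (cmod (f x))\<^sup>2 + (cmod (g x))\<^sup>2)"
    using assms[THEN L2_integrable] by simp
  have "cnj \<in> borel_measurable borel" by (intro borel_measurable_continuous_onI continuous_intros)
  from measurable_compose[OF _ this, measurable]
  show "(\<lambda>x. f x * cnj (g x)) \<in> borel_measurable lebesgue" by measurable
  have "cmod (f x) * cmod (g x) \<le> (cmod (f x))\<^sup>2 + (cmod (g x))\<^sup>2" for x
    using sum_squares_bound[of "cmod (f x)" "cmod (g x)"] mult_nonneg_nonneg[OF norm_ge_zero norm_ge_zero, of "f x" "g x"]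
    by linarith
  then show "AE x in lebesgue. norm (f x * cnj (g x)) \<le> norm ((cmod (f x))\<^sup>2 + (cmod (g x))\<^sup>2)"
    by (auto simp: norm_mult)
qed

lemma L2_inner_add_left:
  "f \<in> L2 \<Longrightarrow> g \<in> L2 \<Longrightarrow> h \<in> L2 \<Longrightarrow> L2_inner (\<lambda>x. f x + g x) h = L2_inner f h + L2_inner g h"
  unfolding L2_inner_def by (simp add: ring_distribs L2_inner_integrable)

lemma L2_inner_scale_left: "L2_inner (\<lambda>x. c * f x) h = c * L2_inner f h"
  unfolding L2_inner_def by (simp add: mult.assoc)

lemma L2_inner_diff_left:
  "f \<in> L2 \<Longrightarrow> g \<in> L2 \<Longrightarrow> h \<in> L2 \<Longrightarrow> L2_inner (\<lambda>x. f x - g x) h = L2_inner f h - L2_inner g h"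
  unfolding L2_inner_def by (simp add: ring_distribs L2_inner_integrable)

lemma L2_inner_commute: "L2_inner g f = cnj (L2_inner f g)"
  unfolding L2_inner_def
  using Bochner_Integration.integral_cnj[of lebesgue "\<lambda>x. f x * cnj (g x)"] by (simp add: mult.commute)

lemma L2_inner_eq_0_commute: "L2_inner g f = 0 \<longleftrightarrow> L2_inner f g = 0"
  by (subst L2_inner_commute) simp

lemma L2_norm_nonneg: "0 \<le> L2_norm f"
  unfolding L2_norm_def by (simp add: integral_nonneg_AE)

lemma L2_norm_sq: "(L2_norm f)\<^sup>2 = (LINT x|lebesgue. (cmod (f x))\<^sup>2)"
  unfolding L2_norm_def by (simp add: integral_nonneg_AE)

lemma L2_inner_self: "L2_inner f f = of_real ((L2_norm f)\<^sup>2)"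
  unfolding L2_inner_def L2_norm_sq
  by (simp flip: integral_complex_of_real add: complex_norm_square del: of_real_power of_real_mult)

lemma L2_nn_norm:
  assumes "f \<in> L2"
  shows "(\<integral>\<^sup>+x. ennreal ((cmod (f x))\<^sup>2) \<partial>lebesgue) = ennreal ((L2_norm f)\<^sup>2)"
  unfolding L2_norm_sq using L2_integrable[OF assms] by (intro nn_integral_eq_integral) auto

lemma L2_norm_scale: "L2_norm (\<lambda>x. c * f x) = cmod c * L2_norm f"
  unfolding L2_norm_def by (simp add: norm_mult power_mult_distrib real_sqrt_mult)

lemma L2_norm_minus_commute: "L2_norm (\<lambda>x. f x - g x) = L2_norm (\<lambda>x. g x - f x)"
  unfolding L2_norm_def by (simp add: norm_minus_commute)

lemma L2_Cauchy_Schwarz: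
  assumes "f \<in> L2" "g \<in> L2"
  shows "cmod (L2_inner f g) \<le> L2_norm f * L2_norm g"
proof -
  let ?a = "L2_norm f" and ?b = "L2_norm g"
  have le: "cmod (L2_inner f g) \<le> (?a + e) * (?b + e)" if e: "e > 0" for e
  proof -
    \<comment> \<open>This weight balances the two terms of the arithmetic-geometric mean
      inequality. Enlarging both norms by \<open>e\<close> keeps it defined when a norm is 0;
      \<open>e\<close> tends to 0 at the end.\<close>
    define t where "t = (?b + e) / (?a + e)"
    have pos: "?a + e > 0" "?b + e > 0" using e L2_norm_nonneg[of f] L2_norm_nonneg[of g] by auto
    then have t: "t > 0" by (simp add: t_def)
    have pt: "norm (f x * cnj (g x)) \<le> (t * (cmod (f x))\<^sup>2 + (cmod (g x))\<^sup>2 / t) / 2" for x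
    proof -
      have "2 * (sqrt t * cmod (f x)) * (cmod (g x) / sqrt t)
          \<le> (sqrt t * cmod (f x))\<^sup>2 + (cmod (g x) / sqrt t)\<^sup>2"
        by (rule sum_squares_bound)
      then show ?thesis using t by (simp add: norm_mult power_mult_distrib power_divide)
    qed
    have "cmod (L2_inner f g) \<le> (LINT x|lebesgue. (t * (cmod (f x))\<^sup>2 + (cmod (g x))\<^sup>2 / t) / 2)"
      unfolding L2_inner_def
      by (rule Bochner_Integration.integral_norm_bound_integral)
        (use L2_inner_integrable[OF assms] assms[THEN L2_integrable] pt in auto)
    also have "\<dots> = (t * ?a\<^sup>2 + ?b\<^sup>2 / t) / 2"
      unfolding L2_norm_sq using assms[THEN L2_integrable] by simp
    also have "\<dots> \<le> (t * (?a + e)\<^sup>2 + (?b + e)\<^sup>2 / t) / 2"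
      using t e L2_norm_nonneg[of f] L2_norm_nonneg[of g]
      by (intro divide_right_mono add_mono mult_left_mono power_mono) auto
    also have "\<dots> = (?a + e) * (?b + e)"
      using pos by (simp add: t_def power2_eq_square)
    finally show ?thesis .
  qed
  have "((\<lambda>e. (?a + e) * (?b + e)) \<longlongrightarrow> (?a + 0) * (?b + 0)) (at_right 0)"
    by (intro tendsto_intros)
  from tendsto_lowerbound[OF this, of "cmod (L2_inner f g)"] show ?thesis
    using le by (auto simp: eventually_at_filter)
qed

lemma L2_norm_add_sq:
  assumes "f \<in> L2" "g \<in> L2"
  shows "(L2_norm (\<lambda>x. f x + g x))\<^sup>2 = (L2_norm f)\<^sup>2 + 2 * Re (L2_inner f g) + (L2_norm g)\<^sup>2"
proof -
  have "(L2_norm (\<lambda>x. f x + g x))\<^sup>2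
      = (LINT x|lebesgue. (cmod (f x))\<^sup>2 + 2 * Re (f x * cnj (g x)) + (cmod (g x))\<^sup>2)"
    unfolding L2_norm_sq by (intro Bochner_Integration.integral_cong refl)
      (simp add: cmod_power2, simp add: power2_eq_square algebra_simps)
  also have "\<dots> = (L2_norm f)\<^sup>2 + 2 * Re (L2_inner f g) + (L2_norm g)\<^sup>2"
    unfolding L2_norm_sq L2_inner_def
    using assms[THEN L2_integrable] L2_inner_integrable[OF assms]
    by (simp del: times_complex.simps add: integral_Re)
  finally show ?thesis .
qed

lemma L2_norm_triangle:
  assumes "f \<in> L2" "g \<in> L2"
  shows "L2_norm (\<lambda>x. f x + g x) \<le> L2_norm f + L2_norm g"
proof (rule power2_le_imp_le)
  have "Re (L2_inner f g) \<le> L2_norm f * L2_norm g"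
    using L2_Cauchy_Schwarz[OF assms] complex_Re_le_cmod order_trans by blast
  then show "(L2_norm (\<lambda>x. f x + g x))\<^sup>2 \<le> (L2_norm f + L2_norm g)\<^sup>2"
    unfolding L2_norm_add_sq[OF assms] by (simp add: power2_sum)
qed (simp add: L2_norm_nonneg)

lemma L2_norm_diff_triangle:
  assumes "f \<in> L2" "g \<in> L2" "h \<in> L2"
  shows "L2_norm (\<lambda>x. f x - h x) \<le> L2_norm (\<lambda>x. f x - g x) + L2_norm (\<lambda>x. g x - h x)"
  using L2_norm_triangle[OF L2_diff[OF assms(1,2)] L2_diff[OF assms(2,3)]] by simp

lemma L2_norm_diff_abs:
  assumes "f \<in> L2" "g \<in> L2"
  shows "\<bar>L2_norm f - L2_norm g\<bar> \<le> L2_norm (\<lambda>x. f x - g x)"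
  using L2_norm_triangle[OF assms(2) L2_diff[OF assms]]
    L2_norm_triangle[OF assms(1) L2_diff[OF assms(2,1)]] L2_norm_minus_commute[of f g]
  by simp

lemma L2_tendsto_norm:
  assumes "L2_tendsto s f F" shows "((\<lambda>i. L2_norm (s i)) \<longlongrightarrow> L2_norm f) F"
proof -
  have "\<And>i. s i \<in> L2" "f \<in> L2" and lim: "((\<lambda>i. L2_norm (\<lambda>x. s i x - f x)) \<longlongrightarrow> 0) F"
    using assms by (auto simp: L2_tendsto_def)
  then have "((\<lambda>i. L2_norm (s i) - L2_norm f) \<longlongrightarrow> 0) F"
    by (intro tendsto_rabs_zero_cancel[OF tendsto_sandwich[OF _ _ tendsto_const lim]] always_eventually)
      (auto intro: L2_norm_diff_abs)
  then show ?thesis by (rule LIM_zero_cancel)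
qed

lemma L2_tendsto_mult_bounded:
  assumes "L2_tendsto s f F" "m \<in> borel_measurable lebesgue" "\<And>x. cmod (m x) \<le> C"
  shows "L2_tendsto (\<lambda>i x. m x * s i x) (\<lambda>x. m x * f x) F"
proof -
  have L: "\<And>i. s i \<in> L2" "f \<in> L2" and lim: "((\<lambda>i. L2_norm (\<lambda>x. s i x - f x)) \<longlongrightarrow> 0) F"
    using assms by (auto simp: L2_tendsto_def)
  have L': "\<And>i. (\<lambda>x. m x * s i x) \<in> L2" "(\<lambda>x. m x * f x) \<in> L2"
    using L2_mult_bounded assms(2,3) L by blast+
  have "((\<lambda>i. L2_norm (\<lambda>x. m x * s i x - m x * f x)) \<longlongrightarrow> 0) F"
  proof (rule tendsto_sandwich[OF _ _ tendsto_const])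
    show "((\<lambda>i. C * L2_norm (\<lambda>x. s i x - f x)) \<longlongrightarrow> 0) F"
      using tendsto_mult[OF tendsto_const[of C] lim] by simp
    have "L2_norm (\<lambda>x. m x * s i x - m x * f x) \<le> C * L2_norm (\<lambda>x. s i x - f x)" for i
    proof -
      have C: "0 \<le> C" using assms(3) norm_ge_zero order_trans by blast
      have "(L2_norm (\<lambda>x. m x * s i x - m x * f x))\<^sup>2 \<le> (LINT x|lebesgue. C\<^sup>2 * (cmod (s i x - f x))\<^sup>2)"
        unfolding L2_norm_sq
      proof (rule integral_mono)
        show "(cmod (m x * s i x - m x * f x))\<^sup>2 \<le> C\<^sup>2 * (cmod (s i x - f x))\<^sup>2" for x
        proof -
          have "cmod (m x * s i x - m x * f x) = cmod (m x) * cmod (s i x - f x)"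
            by (simp flip: norm_mult add: algebra_simps)
          then show ?thesis
            using assms(3)[of x] by (simp add: power_mult_distrib power_mono mult_right_mono)
        qed
      qed (use L2_integrable[OF L2_diff[OF L'(1)[of i] L'(2)]] L2_integrable[OF L2_diff[OF L(1)[of i] L(2)]] in auto)
      also have "\<dots> = (C * L2_norm (\<lambda>x. s i x - f x))\<^sup>2"
        by (simp add: L2_norm_sq power_mult_distrib)
      finally show ?thesis
        using C L2_norm_nonneg by (meson mult_nonneg_nonneg power2_le_imp_le)
    qed
    then show "\<forall>\<^sub>F i in F. L2_norm (\<lambda>x. m x * s i x - m x * f x) \<le> C * L2_norm (\<lambda>x. s i x - f x)"
      by simp
  qed (simp add: L2_norm_nonneg)
  then show ?thesis using L' by (simp add: L2_tendsto_def)
qed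

lemma L2_tendsto_sum:
  assumes "\<And>j. j \<in> J \<Longrightarrow> L2_tendsto (s j) (f j) F"
  shows "L2_tendsto (\<lambda>i x. \<Sum>j\<in>J. s j i x) (\<lambda>x. \<Sum>j\<in>J. f j x) F"
  using assms
proof (induction J rule: infinite_finite_induct)
  case (insert j J)
  let ?S = "\<lambda>i x. \<Sum>j\<in>J. s j i x" and ?f = "\<lambda>x. \<Sum>j\<in>J. f j x"
  have 1: "L2_tendsto (s j) (f j) F" "L2_tendsto ?S ?f F" using insert by auto
  then have L: "\<And>i. s j i \<in> L2" "f j \<in> L2" "\<And>i. ?S i \<in> L2" "?f \<in> L2"
    and lim: "((\<lambda>i. L2_norm (\<lambda>x. s j i x - f j x) + L2_norm (\<lambda>x. ?S i x - ?f x)) \<longlongrightarrow> 0 + 0) F"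
    using tendsto_add unfolding L2_tendsto_def by blast+
  have "((\<lambda>i. L2_norm (\<lambda>x. (s j i x + ?S i x) - (f j x + ?f x))) \<longlongrightarrow> 0) F"
  proof (rule tendsto_sandwich[OF _ _ tendsto_const lim[simplified]])
    have "L2_norm (\<lambda>x. (s j i x + ?S i x) - (f j x + ?f x))
        \<le> L2_norm (\<lambda>x. s j i x - f j x) + L2_norm (\<lambda>x. ?S i x - ?f x)" for i
      using L2_norm_triangle[OF L2_diff[OF L(1)[of i] L(2)] L2_diff[OF L(3)[of i] L(4)]]
      by (simp add: algebra_simps)
    then show "\<forall>\<^sub>F i in F. L2_norm (\<lambda>x. (s j i x + ?S i x) - (f j x + ?f x))
        \<le> L2_norm (\<lambda>x. s j i x - f j x) + L2_norm (\<lambda>x. ?S i x - ?f x)" by simp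
  qed (simp add: L2_norm_nonneg)
  then show ?case using insert L by (simp add: L2_tendsto_def L2_add)
qed (auto simp: L2_tendsto_def L2_zero L2_norm_def)

section \<open>Closed spans and the core space of a wavelet\<close>

lemma subspace_L2: "cfun.subspace L2"
  by (auto simp: cfun.subspace_def L2_zero cscale_def plus_fun_def intro: L2_add L2_scale)

lemma span_subset_L2: "S \<subseteq> L2 \<Longrightarrow> cfun.span S \<subseteq> L2"
  by (intro cfun.span_minimal subspace_L2)

lemma closed_spanI:
  assumes "S \<subseteq> L2" "f \<in> L2"
    and approx: "\<And>e. e > 0 \<Longrightarrow> \<exists>s\<in>cfun.span S. L2_norm (\<lambda>x. f x - s x) < e"
  shows "f \<in> closed_span S"
proof -
  have "\<forall>i::nat. \<exists>s\<in>cfun.span S. L2_norm (\<lambda>x. f x - s x) < 1 / Suc i"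
    using approx by simp
  then obtain s where s: "\<And>i::nat. s i \<in> cfun.span S" "\<And>i. L2_norm (\<lambda>x. f x - s i x) < 1 / Suc i"
    by metis
  have "(\<lambda>i. L2_norm (\<lambda>x. s i x - f x)) \<longlonglongrightarrow> 0"
  proof (rule tendsto_sandwich[OF _ _ tendsto_const])
    show "(\<lambda>i. 1 / real (Suc i)) \<longlonglongrightarrow> 0" using LIMSEQ_inverse_real_of_nat by (simp add: inverse_eq_divide)
    show "\<forall>\<^sub>F i in sequentially. L2_norm (\<lambda>x. s i x - f x) \<le> 1 / real (Suc i)"
      unfolding L2_norm_minus_commute[of _ f] using s(2) by (intro always_eventually allI less_imp_le)
  qed (simp add: L2_norm_nonneg)
  then show ?thesis
    using s(1) span_subset_L2[OF assms(1)] assms(2) unfolding closed_span_def L2_tendsto_def by blast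
qed

lemma closed_span_subset_L2: "closed_span S \<subseteq> L2"
  by (auto simp: closed_span_def L2_tendsto_def)

lemma closed_span_approx:
  assumes "f \<in> closed_span S" "e > 0"
  obtains s where "s \<in> cfun.span S" "s \<in> L2" "L2_norm (\<lambda>x. f x - s x) < e"
proof -
  obtain s :: "nat \<Rightarrow> real \<Rightarrow> complex"
    where s: "\<And>i. s i \<in> cfun.span S" "L2_tendsto s f sequentially"
    using assms(1) by (auto simp: closed_span_def)
  then have "\<forall>\<^sub>F i in sequentially. L2_norm (\<lambda>x. s i x - f x) < e"
    using assms(2) by (auto simp: L2_tendsto_def intro: order_tendstoD)
  then obtain i where "L2_norm (\<lambda>x. s i x - f x) < e"
    by (auto dest: eventually_happens)
  with s show thesis
    by (intro that[of "s i"]) (auto simp: L2_tendsto_def L2_norm_minus_commute[of f])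
qed

lemma span_orth:
  assumes "S \<subseteq> L2" "g \<in> L2" "\<And>h. h \<in> S \<Longrightarrow> L2_inner h g = 0" "f \<in> cfun.span S"
  shows "L2_inner f g = 0"
proof -
  have "cfun.subspace {f \<in> L2. L2_inner f g = 0}"
    using assms(2) subspace_L2
    by (auto simp: cfun.subspace_def cscale_def plus_fun_def L2_inner_add_left L2_inner_scale_left)
      (auto simp: L2_inner_def)
  from cfun.span_minimal[OF _ this, of S] show ?thesis using assms by blast
qed

lemma closed_span_orth:
  assumes "S \<subseteq> L2" "g \<in> L2" "\<And>h. h \<in> S \<Longrightarrow> L2_inner h g = 0" "f \<in> closed_span S"
  shows "L2_inner f g = 0"
proof -
  have f: "f \<in> L2" using assms(4) closed_span_subset_L2 by blast
  have "cmod (L2_inner f g) \<le> e" if "e > 0" for e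
  proof -
    \<comment> \<open>The 1 guards against a vanishing norm of \<open>g\<close>.\<close>
    have "e / (L2_norm g + 1) > 0" using that L2_norm_nonneg[of g] by simp
    then obtain s where s: "s \<in> cfun.span S" "s \<in> L2" "L2_norm (\<lambda>x. f x - s x) < e / (L2_norm g + 1)"
      using closed_span_approx[OF assms(4)] by blast
    have "L2_inner f g = L2_inner (\<lambda>x. f x - s x) g"
      using span_orth[OF assms(1-3) s(1)] f s(2) assms(2) by (simp add: L2_inner_diff_left)
    also have "cmod \<dots> \<le> L2_norm (\<lambda>x. f x - s x) * L2_norm g"
      by (intro L2_Cauchy_Schwarz L2_diff f s assms)
    also have "\<dots> \<le> e / (L2_norm g + 1) * (L2_norm g + 1)"
      using s(3) L2_norm_nonneg[of g] that by (intro mult_mono) auto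
    also have "\<dots> = e" using L2_norm_nonneg[of g] by (simp add: add_nonneg_eq_0_iff)
    finally show ?thesis .
  qed
  from field_le_epsilon[of "cmod (L2_inner f g)" 0] this show ?thesis by simp
qed

text \<open>Dropping the \<open>C\<close>-part of an approximation of a vector orthogonal to \<open>C\<close> only improves it;
  this replaces the orthogonal projection onto \<open>closed_span B\<close>.\<close>

lemma closed_span_eq_orthogonal:
  assumes sub: "B \<subseteq> L2" "C \<subseteq> L2" and total: "closed_span (B \<union> C) = L2"
    and orth: "\<And>b c. b \<in> B \<Longrightarrow> c \<in> C \<Longrightarrow> L2_inner b c = 0"
  shows "closed_span B = {f \<in> L2. \<forall>c\<in>C. L2_inner f c = 0}"
proof (intro equalityI subsetI)
  fix f assume "f \<in> closed_span B"
  then show "f \<in> {f \<in> L2. \<forall>c\<in>C. L2_inner f c = 0}"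
    using closed_span_orth[OF sub(1)] sub(2) orth closed_span_subset_L2 by blast
next
  fix f assume "f \<in> {f \<in> L2. \<forall>c\<in>C. L2_inner f c = 0}"
  then have f: "f \<in> L2" "\<And>c. c \<in> C \<Longrightarrow> L2_inner f c = 0" by auto
  show "f \<in> closed_span B"
  proof (rule closed_spanI[OF sub(1) f(1)])
    fix e :: real assume "e > 0"
    then obtain s where s: "s \<in> cfun.span (B \<union> C)" "L2_norm (\<lambda>x. f x - s x) < e"
      using closed_span_approx[of f "B \<union> C" e] f(1) total by auto
    then obtain p q where pq: "s = (\<lambda>x. p x + q x)" "p \<in> cfun.span B" "q \<in> cfun.span C"
      unfolding cfun.span_Un by (auto simp: plus_fun_def)
    have p: "p \<in> L2" and q: "q \<in> L2" using pq span_subset_L2 sub by auto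
    have C: "L2_inner c f = 0" if "c \<in> C" for c
      using f(2)[OF that] L2_inner_eq_0_commute by blast
    have "L2_inner p c = 0" if "c \<in> C" for c
      using span_orth[OF sub(1) _ orth pq(2), of c] that sub(2) by auto
    then have "L2_inner q p = 0"
      using span_orth[OF sub(2) p _ pq(3)] L2_inner_eq_0_commute by blast
    moreover have "L2_inner q f = 0" using span_orth[OF sub(2) f(1) C pq(3)] by simp
    ultimately have "L2_inner (\<lambda>x. f x - p x) (\<lambda>x. -1 * q x) = 0"
      using L2_inner_eq_0_commute[of q "\<lambda>x. f x - p x"] L2_inner_eq_0_commute[of q p]
        L2_inner_eq_0_commute[of q f] f(1) p q
      by (subst L2_inner_eq_0_commute, subst L2_inner_scale_left) (auto simp: L2_inner_diff_left)
    from L2_norm_add_sq[OF L2_diff[OF f(1) p] L2_scale[OF q, of "-1"]] this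
    have "(L2_norm (\<lambda>x. f x - s x))\<^sup>2 = (L2_norm (\<lambda>x. f x - p x))\<^sup>2 + (L2_norm (\<lambda>x. - q x))\<^sup>2"
      by (simp add: pq(1) algebra_simps)
    then have "(L2_norm (\<lambda>x. f x - p x))\<^sup>2 \<le> (L2_norm (\<lambda>x. f x - s x))\<^sup>2" by simp
    then have "L2_norm (\<lambda>x. f x - p x) \<le> L2_norm (\<lambda>x. f x - s x)"
      using L2_norm_nonneg by (rule power2_le_imp_le)
    then show "\<exists>s\<in>cfun.span B. L2_norm (\<lambda>x. f x - s x) < e"
      using s(2) pq(2) order_le_less_trans by blast
  qed
qed

section \<open>Dilations, translations and the integer shifts of a function\<close>

abbreviation dil :: "int \<Rightarrow> (real \<Rightarrow> complex) \<Rightarrow> real \<Rightarrow> complex" where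
  "dil j \<equiv> op_powi dilation j"

lemma L2_affine:
  assumes "f \<in> L2" "c \<noteq> 0" shows "(\<lambda>x. f (t + c * x)) \<in> L2"
proof -
  have "(\<lambda>x. t + c * x) \<in> lebesgue \<rightarrow>\<^sub>M lebesgue"
    using lebesgue_affine_measurable[of "\<lambda>_. c" t] assms(2) by simp
  from measurable_compose[OF this L2_measurable[OF assms(1)]] show ?thesis
    using lebesgue_integrable_real_affine[OF L2_integrable[OF assms(1)] assms(2)]
    by (simp add: L2_def)
qed

lemma L2_translation: "f \<in> L2 \<Longrightarrow> translation a f \<in> L2"
  using L2_affine[of f 1 "-a"] by (simp add: translation_def)

lemma L2_dil: "f \<in> L2 \<Longrightarrow> dil j f \<in> L2"
  using L2_scale[OF L2_affine[of f "2 powi j" 0]] by (simp add: op_powi_dilation)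

lemma L2_inner_translation: "L2_inner (translation a f) (translation a g) = L2_inner f g"
  using lebesgue_integral_real_affine[of 1 "\<lambda>x. f x * cnj (g x)" "-a"]
  by (simp add: L2_inner_def translation_def)

lemma L2_inner_dil: "L2_inner (dil j f) (dil j g) = L2_inner f g"
proof -
  have "(sqrt 2 powi j)\<^sup>2 = 2 powi j"
    by (simp flip: power_int_mult_distrib add: power2_eq_square)
  then have "complex_of_real (sqrt 2 powi j) * complex_of_real (sqrt 2 powi j) = complex_of_real (2 powi j)"
    by (metis of_real_mult power2_eq_square)
  then have "c * a * (c * b) = complex_of_real (2 powi j) * (a * b)"
    if "c = complex_of_real (sqrt 2 powi j)" for a b c
    unfolding that by (metis mult.assoc mult.left_commute)
  then have "L2_inner (dil j f) (dil j g)
      = (LINT x|lebesgue. complex_of_real (2 powi j) * (f (2 powi j * x) * cnj (g (2 powi j * x))))"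
    unfolding L2_inner_def op_powi_dilation complex_cnj_mult complex_cnj_complex_of_real by (simp only:)
  then show ?thesis
    using lebesgue_integral_real_affine[of "2 powi j" "\<lambda>x. f x * cnj (g x)" 0]
    by (simp add: L2_inner_def scaleR_conv_of_real)
qed

lemma dil_dil: "dil j (dil k f) = dil (j + k) f"
  by (simp add: op_powi_dilation power_int_add mult_ac)

lemma dil_0: "dil 0 f = f"
  by (simp add: op_powi_dilation)

lemma translation_translation: "translation a (translation b f) = translation (a + b) f"
  by (simp add: translation_def algebra_simps)

lemma translation_0: "translation 0 f = f"
  by (simp add: translation_def)

lemma translation_dil: "translation a (dil j f) = dil j (translation (2 powi j * a) f)"
  by (simp add: op_powi_dilation translation_def algebra_simps)

lemma L2_inner_translation_adjoint: "L2_inner (translation a f) g = L2_inner f (translation (- a) g)"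
  using L2_inner_translation[of a f "translation (- a) g"]
  by (simp add: translation_translation translation_0)

lemma L2_inner_dil_adjoint: "L2_inner (dil j f) g = L2_inner f (dil (- j) g)"
  using L2_inner_dil[of j f "dil (- j) g"] by (simp add: dil_dil dil_0)

lemma affine_system_eq: "affine_system \<psi> j l = dil j (translation (of_int l) \<psi>)"
  by (simp add: affine_system_def op_powi_translation)

text \<open>Explicit coefficients are needed because they become those of the trigonometric
  polynomial \<open>exp_sum\<close> under the Fourier transform.\<close>

lemma span_shifts:
  assumes "f \<in> cfun.span (range (\<lambda>l. affine_system \<psi> 0 l))"
  obtains L c where "finite L" "f = (\<lambda>x. \<Sum>l\<in>L. c l * translation (of_int l) \<psi> x)"
proof -
  have "\<exists>L c. finite L \<and> f = (\<lambda>x. \<Sum>l\<in>L. c l * translation (of_int l) \<psi> x)"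
    using assms
  proof (induction rule: cfun.span_induct_alt)
    case base
    then show ?case by (intro exI[of _ "{}"]) (simp add: zero_fun_def)
  next
    case (step a g h)
    then obtain l0 L c where g: "g = translation (of_int l0) \<psi>"
      and L: "finite L" "h = (\<lambda>x. \<Sum>l\<in>L. c l * translation (of_int l) \<psi> x)"
      by (auto simp: affine_system_eq dil_0)
    \<comment> \<open>The index \<open>l0\<close> may already lie in \<open>L\<close>, so
      contributions are added; \<open>c\<close> is cut off because its values outside
      \<open>L\<close> are arbitrary.\<close>
    define c' where "c' l = (if l \<in> L then c l else 0) + (if l = l0 then a else 0)" for l
    have "cscale a g + h = (\<lambda>x. \<Sum>l\<in>insert l0 L. c' l * translation (of_int l) \<psi> x)"
    proof
      fix x
      have "(\<Sum>l\<in>insert l0 L. c' l * translation (of_int l) \<psi> x)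
          = (\<Sum>l\<in>insert l0 L. if l \<in> L then c l * translation (of_int l) \<psi> x else 0)
            + (\<Sum>l\<in>insert l0 L. if l = l0 then a * translation (of_int l) \<psi> x else 0)"
        unfolding sum.distrib[symmetric] by (intro sum.cong) (auto simp: c'_def algebra_simps)
      also have "(\<Sum>l\<in>insert l0 L. if l \<in> L then c l * translation (of_int l) \<psi> x else 0) = h x"
        unfolding L(2) using L(1) by (intro sum.mono_neutral_cong_right) auto
      also have "(\<Sum>l\<in>insert l0 L. if l = l0 then a * translation (of_int l) \<psi> x else 0) = a * g x"
        using L(1) by (simp add: sum.delta g)
      finally show "(cscale a g + h) x = (\<Sum>l\<in>insert l0 L. c' l * translation (of_int l) \<psi> x)"
        by (simp add: plus_fun_def cscale_def)
    qed
    then show ?case using L(1) by blast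
  qed
  then show thesis using that by blast
qed

lemma shifts_in_span:
  "(\<lambda>x. \<Sum>l\<in>L. c l * translation (of_int l) \<psi> x) \<in> cfun.span (range (\<lambda>l. affine_system \<psi> 0 l))"
proof -
  have "(\<Sum>l\<in>L. cscale (c l) (affine_system \<psi> 0 l)) = (\<lambda>x. \<Sum>l\<in>L. c l * translation (of_int l) \<psi> x)"
    by (induction L rule: infinite_finite_induct)
      (auto simp: fun_eq_iff cscale_def affine_system_eq dil_0)
  moreover have "(\<Sum>l\<in>L. cscale (c l) (affine_system \<psi> 0 l)) \<in> cfun.span (range (\<lambda>l. affine_system \<psi> 0 l))"
    by (intro cfun.span_sum cfun.span_scale cfun.span_base) auto
  ultimately show ?thesis by simp
qed

text \<open>Moving a translation past a dilation by 2^k multiplies its amount by 2^k. For k >= 0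
  this stays in the group 2^{-n} Z, which is why the comparison of scales below always arranges
  nonnegative exponents.\<close>

lemma dyadic_scale: "\<exists>m'. 2 ^ k * (of_int m / 2 ^ n) = (of_int m' / 2 ^ n :: real)"
  by (rule exI[of _ "2 ^ k * m"]) simp

context
  fixes \<psi> assumes wavelet: "wavelet \<psi>"
begin

lemma wavelet_L2: "\<psi> \<in> L2"
  using wavelet by (simp add: wavelet_def)

lemma affine_system_L2: "affine_system \<psi> j l \<in> L2"
  by (simp add: affine_system_eq L2_dil L2_translation wavelet_L2)

lemma wavelet_orth: "(j, l) \<noteq> (j', l') \<Longrightarrow> L2_inner (affine_system \<psi> j l) (affine_system \<psi> j' l') = 0"
  using wavelet by (auto simp: wavelet_def)

text \<open>Splitting the orthonormal basis by scale gives two mutually orthogonal families with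
  total union, so \<open>closed_span_eq_orthogonal\<close> applies.\<close>

lemma closed_span_scales:
  "closed_span {affine_system \<psi> j l | j l. j \<in> J}
    = {f \<in> L2. \<forall>j l. j \<notin> J \<longrightarrow> L2_inner f (affine_system \<psi> j l) = 0}" (is "?L = _")
proof -
  let ?B = "{affine_system \<psi> j l | j l. j \<in> J}" and ?C = "{affine_system \<psi> j l | j l. j \<notin> J}"
  have "?B \<union> ?C = {affine_system \<psi> j l | j l. True}" by blast
  then have "closed_span (?B \<union> ?C) = L2" using wavelet by (simp add: wavelet_def)
  then have "?L = {f \<in> L2. \<forall>c\<in>?C. L2_inner f c = 0}"
  proof (intro closed_span_eq_orthogonal)
    fix b c assume "b \<in> ?B" "c \<in> ?C"
    then obtain j l j' l' where "b = affine_system \<psi> j l" "c = affine_system \<psi> j' l'" "j \<in> J" "j' \<notin> J"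
      by blast
    then show "L2_inner b c = 0" using wavelet_orth[of j l j' l'] by auto
  qed (use affine_system_L2 in blast)+
  then show ?thesis by blast
qed

lemma core_space_eq:
  "core_space \<psi> = {f \<in> L2. \<forall>j l. j \<ge> 0 \<longrightarrow> L2_inner f (affine_system \<psi> j l) = 0}"
  using closed_span_scales[of "{..<0}"] by (simp add: core_space_def not_less)

lemma shift_space_eq:
  "closed_span (range (\<lambda>l. affine_system \<psi> 0 l))
    = {f \<in> L2. \<forall>j l. j \<noteq> 0 \<longrightarrow> L2_inner f (affine_system \<psi> j l) = 0}"
proof -
  have "{affine_system \<psi> j l | j l. j \<in> {0}} = range (\<lambda>l. affine_system \<psi> 0 l)" by auto
  then show ?thesis using closed_span_scales[of "{0}"] by simp
qed

text \<open>Both spaces are orthogonal complements: the core space of the scales j >= 0, the shift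
  space of the scales j \<noteq> 0. Each direction is thus a check of inner products, with
  translations and dilations moved across by unitarity.\<close>

lemma core_space_invariant_iff:
  "(\<forall>U\<in>translation_group n. U ` core_space \<psi> \<subseteq> core_space \<psi>) \<longleftrightarrow>
   (\<forall>m::int. translation (of_int m / 2 ^ n) \<psi> \<in> closed_span (range (\<lambda>l. affine_system \<psi> 0 l)))"
  (is "?inv \<longleftrightarrow> ?shift")
proof
  assume inv: ?inv
  have V: "translation (of_int m / 2 ^ n) f \<in> core_space \<psi>" if "f \<in> core_space \<psi>" for m :: int and f
    using inv that by (auto simp: translation_group_def)
  have neg: "affine_system \<psi> j l \<in> core_space \<psi>" if "j < 0" for j l
    using that wavelet_orth[of j l] affine_system_L2 by (auto simp: core_space_eq)
  have orth0: "L2_inner f (translation (of_int l) \<psi>) = 0" if "f \<in> core_space \<psi>" for f l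
  proof -
    have "L2_inner f (affine_system \<psi> 0 l) = 0" using that by (simp add: core_space_eq)
    then show ?thesis by (simp add: affine_system_eq dil_0)
  qed
  have "L2_inner (translation (of_int m / 2 ^ n) \<psi>) (affine_system \<psi> j l) = 0" if "j \<noteq> 0" for m j l
  proof (cases "j < 0")
    case True
    \<comment> \<open>For negative scales the translation is moved to the other side: the inverse
      translate of a core vector is again in the core space, hence orthogonal to \<psi>.\<close>
    have "translation (of_int (- m) / 2 ^ n) (affine_system \<psi> j l) \<in> core_space \<psi>"
      by (rule V[OF neg[OF True]])
    from orth0[OF this, of 0]
    have "L2_inner (translation (- (of_int m / 2 ^ n)) (affine_system \<psi> j l)) \<psi> = 0"
      by (simp add: translation_0)
    then show ?thesis
      unfolding L2_inner_translation_adjoint[of _ \<psi>] using L2_inner_eq_0_commute by blast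
  next
    case False
    define k where "k = nat j"
    have k: "j = int k" using False by (simp add: k_def)
    obtain m' :: int where m': "2 ^ k * (of_int m / 2 ^ n) = (of_int m' / 2 ^ n :: real)"
      using dyadic_scale by blast
    \<comment> \<open>For positive scales both arguments are dilated by -j. Then D^{-j} T_a \<psi> =
      T_{2^j a} D^{-j} \<psi> is a translate of a core vector, and it is paired with an integer
      shift of \<psi>.\<close>
    have "affine_system \<psi> (- j) 0 = dil (- j) \<psi>"
      by (simp add: affine_system_eq translation_0)
    then have "translation (of_int m' / 2 ^ n) (dil (- j) \<psi>) \<in> core_space \<psi>"
      using V[OF neg[of "- j" 0], of m'] that False by simp
    from orth0[OF this, of l] have "L2_inner (translation (of_int m' / 2 ^ n) (dil (- j) \<psi>))
        (translation (of_int l) \<psi>) = 0" .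
    moreover have "translation (of_int m' / 2 ^ n) (dil (- j) \<psi>) = dil (- j) (translation (of_int m / 2 ^ n) \<psi>)"
      unfolding translation_dil by (simp add: m'[symmetric] k power_int_minus field_simps)
    ultimately show ?thesis
      by (simp add: affine_system_eq L2_inner_dil_adjoint)
  qed
  then show ?shift by (auto simp: shift_space_eq L2_translation wavelet_L2)
next
  assume shift: ?shift
  have orth: "L2_inner (affine_system \<psi> j l) (translation (of_int m / 2 ^ n) \<psi>) = 0" if "j \<noteq> 0" for j l m
    using shift that by (subst L2_inner_eq_0_commute) (auto simp: shift_space_eq)
  show ?inv
  proof (clarsimp simp: translation_group_def)
    fix m :: int and f assume f: "f \<in> core_space \<psi>"
    have "L2_inner (translation (of_int m / 2 ^ n) f) (affine_system \<psi> j l) = 0" if j: "j \<ge> 0" for j l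
    proof -
      define k where "k = nat j"
      have k: "j = int k" using j by (simp add: k_def)
      obtain m' :: int where m': "2 ^ k * (of_int m / 2 ^ n) = (of_int m' / 2 ^ n :: real)"
        using dyadic_scale by blast
      \<comment> \<open>With a = m / 2^n this is l - 2^j a, the amount left when T_{-a} is moved
        past D^j onto T^l \<psi>; it again lies in 2^{-n} Z.\<close>
      let ?b = "of_int (l * 2 ^ n - m') / 2 ^ n :: real"
      have b: "?b = of_int l - of_int m' / 2 ^ n" by (simp add: field_simps)
      have eq: "translation (- (of_int m / 2 ^ n)) (affine_system \<psi> j l) = dil j (translation ?b \<psi>)"
        unfolding affine_system_eq translation_dil translation_translation b m'[symmetric]
        by (simp add: k add.commute)
      have "L2_inner f (dil j (translation ?b \<psi>)) = 0"
      proof (rule closed_span_orth)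
        show "f \<in> closed_span {affine_system \<psi> j l | j l. j < 0}"
          using f by (simp add: core_space_def)
        show "L2_inner h (dil j (translation ?b \<psi>)) = 0" if h: "h \<in> {affine_system \<psi> j l | j l. j < 0}" for h
        proof -
          obtain i l' where i: "h = affine_system \<psi> i l'" "i < 0" using h by auto
          \<comment> \<open>Dilating by -j takes scale i < 0 to i - j, still nonzero because j >= 0,
            so \<open>orth\<close> applies.\<close>
          have "dil (- j) h = affine_system \<psi> (i - j) l'"
            by (simp add: i affine_system_eq dil_dil)
          then show ?thesis
            using orth[of "i - j" l' "l * 2 ^ n - m'"] L2_inner_dil_adjoint[of "-j" h "translation ?b \<psi>"] i j by simp
        qed
      qed (auto simp: affine_system_L2 L2_dil L2_translation wavelet_L2)
      then show ?thesis unfolding L2_inner_translation_adjoint eq .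
    qed
    then show "translation (of_int m / 2 ^ n) f \<in> core_space \<psi>"
      using f by (auto simp: core_space_eq L2_translation)
  qed
qed

end

section \<open>Density of Laurent polynomials on the circle\<close>

lemma ennreal_add_strict_mono:
  fixes a b c d :: ennreal
  assumes "a < c" "b < d" shows "a + b < c + d"
proof -
  have "a + b < a + d" using assms by (auto simp: ennreal_add_left_cancel_less)
  also have "\<dots> \<le> c + d" using assms by (intro add_right_mono) simp
  finally show ?thesis .
qed

definition laurent :: "int set \<Rightarrow> (int \<Rightarrow> complex) \<Rightarrow> complex \<Rightarrow> complex" where
  "laurent K a z = (\<Sum>k\<in>K. a k * z powi k)"

text \<open>Agreement is demanded on the circle alone: there conjugation is inversion, so real
  polynomials in Re z and Im z become Laurent polynomials.\<close>

definition laurent_on_circle :: "(complex \<Rightarrow> complex) \<Rightarrow> bool" where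
  "laurent_on_circle f \<longleftrightarrow> (\<exists>K a. finite K \<and> (\<forall>z. cmod z = 1 \<longrightarrow> f z = laurent K a z))"

lemma borel_measurable_power_int: "(\<lambda>z::complex. z powi k) \<in> borel_measurable borel"
  by (cases "k \<ge> 0") (auto simp: power_int_def)

lemma borel_measurable_laurent [measurable]: "laurent K a \<in> borel_measurable borel"
  unfolding laurent_def using borel_measurable_power_int by (auto intro!: borel_measurable_sum)

lemma laurent_add:
  assumes "finite K" "finite L"
  obtains M c where "finite M" "\<And>z. laurent K a z + laurent L b z = laurent M c z"
proof
  let ?c = "\<lambda>k. (if k \<in> K then a k else 0) + (if k \<in> L then b k else 0)"
  show "finite (K \<union> L)" using assms by simp
  show "laurent K a z + laurent L b z = laurent (K \<union> L) ?c z" for z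
  proof -
    have "laurent (K \<union> L) ?c z = (\<Sum>k\<in>K \<union> L. if k \<in> K then a k * z powi k else 0)
        + (\<Sum>k\<in>K \<union> L. if k \<in> L then b k * z powi k else 0)"
      unfolding laurent_def sum.distrib[symmetric] by (intro sum.cong) (auto simp: algebra_simps)
    also have "(\<Sum>k\<in>K \<union> L. if k \<in> K then a k * z powi k else 0) = laurent K a z"
      unfolding laurent_def using assms by (intro sum.mono_neutral_cong_right) auto
    also have "(\<Sum>k\<in>K \<union> L. if k \<in> L then b k * z powi k else 0) = laurent L b z"
      unfolding laurent_def using assms by (intro sum.mono_neutral_cong_right) auto
    finally show ?thesis by simp
  qed
qed

lemma laurent_scale: "c * laurent K a z = laurent K (\<lambda>k. c * a k) z"
  by (simp add: laurent_def sum_distrib_left mult.assoc)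

lemma laurent_on_circle_add:
  "laurent_on_circle f \<Longrightarrow> laurent_on_circle g \<Longrightarrow> laurent_on_circle (\<lambda>z. f z + g z)"
  unfolding laurent_on_circle_def by (metis laurent_add)

lemma laurent_on_circle_scale: "laurent_on_circle f \<Longrightarrow> laurent_on_circle (\<lambda>z. c * f z)"
  unfolding laurent_on_circle_def by (metis laurent_scale)

lemma laurent_on_circle_power_int: "laurent_on_circle (\<lambda>z. z powi k)"
  unfolding laurent_on_circle_def laurent_def
  by (intro exI[of _ "{k}"] exI[of _ "\<lambda>_. 1"]) simp

lemma laurent_on_circle_const: "laurent_on_circle (\<lambda>z. c)"
  using laurent_on_circle_scale[OF laurent_on_circle_power_int[of 0], of c] by simp

lemma laurent_on_circle_cong:
  "laurent_on_circle f \<Longrightarrow> (\<And>z. cmod z = 1 \<Longrightarrow> g z = f z) \<Longrightarrow> laurent_on_circle g"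
  unfolding laurent_on_circle_def by auto

lemma laurent_on_circle_sum:
  "(\<And>i. i \<in> I \<Longrightarrow> laurent_on_circle (f i)) \<Longrightarrow> laurent_on_circle (\<lambda>z. \<Sum>i\<in>I. f i z)"
  by (induction I rule: infinite_finite_induct)
    (auto intro: laurent_on_circle_const laurent_on_circle_add)

lemma laurent_on_circle_mult:
  assumes "laurent_on_circle f" "laurent_on_circle g"
  shows "laurent_on_circle (\<lambda>z. f z * g z)"
proof -
  obtain K a where K: "\<And>z. cmod z = 1 \<Longrightarrow> f z = laurent K a z"
    using assms(1) by (auto simp: laurent_on_circle_def)
  obtain L b where L: "\<And>z. cmod z = 1 \<Longrightarrow> g z = laurent L b z"
    using assms(2) by (auto simp: laurent_on_circle_def)
  have "laurent_on_circle (\<lambda>z. \<Sum>k\<in>K. \<Sum>l\<in>L. (a k * b l) * z powi (k + l))"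
    by (intro laurent_on_circle_sum laurent_on_circle_scale laurent_on_circle_power_int)
  then show ?thesis
  proof (rule laurent_on_circle_cong)
    fix z :: complex assume z: "cmod z = 1"
    then have "z \<noteq> 0" by auto
    then show "f z * g z = (\<Sum>k\<in>K. \<Sum>l\<in>L. (a k * b l) * z powi (k + l))"
      unfolding K[OF z] L[OF z] laurent_def
      by (simp add: sum_product power_int_add algebra_simps)
  qed
qed

lemma laurent_on_circle_real_polynomial:
  fixes p :: "complex \<Rightarrow> real"
  assumes "real_polynomial_function p"
  shows "laurent_on_circle (\<lambda>z. of_real (p z))"
  using assms
proof induction
  case (linear p)
  then interpret bounded_linear p .
  \<comment> \<open>On the circle Re z = (z + 1/z) / 2 and Im z = (z - 1/z) / (2 i), substituted
    into p z = Re z * p 1 + Im z * p i.\<close>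
  let ?q = "\<lambda>z. (p 1 / 2 - \<i> * p \<i> / 2) * z powi 1 + (p 1 / 2 + \<i> * p \<i> / 2) * z powi (-1)"
  have "laurent_on_circle ?q"
    by (intro laurent_on_circle_add laurent_on_circle_scale laurent_on_circle_power_int)
  then show ?case
  proof (rule laurent_on_circle_cong)
    fix z :: complex assume z: "cmod z = 1"
    have "p z = p (Re z *\<^sub>R 1 + Im z *\<^sub>R \<i>)"
      by (rule arg_cong[where f = p]) (simp add: complex_eq_iff)
    then have p: "p z = Re z * p 1 + Im z * p \<i>" by (simp add: add scaleR)
    have "inverse z = cnj z" using z by (intro inverse_unique) (simp flip: complex_norm_square)
    then show "of_real (p z) = ?q z"
      unfolding p by (simp add: complex_eq_iff power_int_minus algebra_simps)
  qed
qed (auto intro: laurent_on_circle_const laurent_on_circle_add laurent_on_circle_mult)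

text \<open>Here a polynomial function is one with real polynomial components, so it may involve
  conjugates; negative exponents absorb them.\<close>

lemma laurent_on_circle_polynomial:
  fixes p :: "complex \<Rightarrow> complex"
  assumes "polynomial_function p"
  shows "laurent_on_circle p"
proof -
  have "laurent_on_circle (\<lambda>z. of_real ((Re \<circ> p) z) + \<i> * of_real ((Im \<circ> p) z))"
    using assms unfolding polynomial_function_def
    by (intro laurent_on_circle_add laurent_on_circle_scale laurent_on_circle_real_polynomial)
      (use bounded_linear_Re bounded_linear_Im in blast)+
  then show ?thesis by (rule laurent_on_circle_cong) (simp add: complex_eq_iff)
qed

text \<open>The measure lives on the whole plane and is concentrated on the circle, so that
  pushforwards along \<open>cis\<close> are direct instances.\<close>

locale circle_measure = finite_measure \<nu> for \<nu> :: "complex measure" +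
  assumes sets_nu [measurable_cong]: "sets \<nu> = sets borel"
    and AE_circle: "AE z in \<nu>. cmod z = 1"
begin

definition approximable :: "(complex \<Rightarrow> complex) \<Rightarrow> bool" where
  "approximable f \<longleftrightarrow> f \<in> borel_measurable borel \<and>
     (\<forall>e>0. \<exists>K a. finite K \<and> (\<integral>\<^sup>+z. ennreal ((cmod (f z - laurent K a z))\<^sup>2) \<partial>\<nu>) < ennreal e)"

lemma space_nu: "space \<nu> = UNIV"
  using sets_eq_imp_space_eq[OF sets_nu] by simp

lemma constant_finite: "(\<integral>\<^sup>+z. ennreal c \<partial>\<nu>) < \<infinity>"
proof -
  have "emeasure \<nu> UNIV < \<infinity>" using emeasure_finite[of UNIV] less_top by (metis infinity_ennreal_def)
  then show ?thesis by (simp add: space_nu ennreal_mult_less_top)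
qed

lemma approximable_add:
  assumes "approximable f" "approximable g"
  shows "approximable (\<lambda>z. f z + g z)"
  unfolding approximable_def
proof (intro conjI allI impI)
  note [measurable] = assms[unfolded approximable_def, THEN conjunct1]
  show "(\<lambda>z. f z + g z) \<in> borel_measurable borel" by measurable
  fix e :: real assume "e > 0"
  \<comment> \<open>Squared errors are added by \<open>cmod_add_sq_le\<close>, which doubles each: 2
    (e/4) + 2 (e/4) = e.\<close>
  then have e: "e / 4 > 0" by simp
  obtain K a L b where K: "finite K" "(\<integral>\<^sup>+z. ennreal ((cmod (f z - laurent K a z))\<^sup>2) \<partial>\<nu>) < ennreal (e/4)"
    and L: "finite L" "(\<integral>\<^sup>+z. ennreal ((cmod (g z - laurent L b z))\<^sup>2) \<partial>\<nu>) < ennreal (e/4)"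
    using assms e unfolding approximable_def by blast
  obtain M c where M: "finite M" "\<And>z. laurent K a z + laurent L b z = laurent M c z"
    using laurent_add[OF K(1) L(1)] by blast
  have "(\<integral>\<^sup>+z. ennreal ((cmod (f z + g z - laurent M c z))\<^sup>2) \<partial>\<nu>)
      \<le> (\<integral>\<^sup>+z. 2 * ennreal ((cmod (f z - laurent K a z))\<^sup>2) + 2 * ennreal ((cmod (g z - laurent L b z))\<^sup>2) \<partial>\<nu>)"
  proof (intro nn_integral_mono)
    fix z
    have "(cmod (f z + g z - laurent M c z))\<^sup>2
        \<le> 2 * (cmod (f z - laurent K a z))\<^sup>2 + 2 * (cmod (g z - laurent L b z))\<^sup>2"
      using cmod_add_sq_le[of "f z - laurent K a z" "g z - laurent L b z"]
      by (simp add: M(2)[symmetric] algebra_simps)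
    then show "ennreal ((cmod (f z + g z - laurent M c z))\<^sup>2)
        \<le> 2 * ennreal ((cmod (f z - laurent K a z))\<^sup>2) + 2 * ennreal ((cmod (g z - laurent L b z))\<^sup>2)"
      by (simp flip: ennreal_plus ennreal_mult' ennreal_numeral)
  qed
  also have "\<dots> = 2 * (\<integral>\<^sup>+z. ennreal ((cmod (f z - laurent K a z))\<^sup>2) \<partial>\<nu>)
      + 2 * (\<integral>\<^sup>+z. ennreal ((cmod (g z - laurent L b z))\<^sup>2) \<partial>\<nu>)"
    by (simp add: nn_integral_add nn_integral_cmult)
  also have "\<dots> < 2 * ennreal (e/4) + 2 * ennreal (e/4)"
    using K(2) L(2) by (intro ennreal_add_strict_mono ennreal_mult_strict_left_mono) auto
  also have "\<dots> = ennreal e" using \<open>e > 0\<close> by (simp flip: ennreal_plus ennreal_mult' ennreal_numeral)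
  finally show "\<exists>K a. finite K \<and> (\<integral>\<^sup>+z. ennreal ((cmod (f z + g z - laurent K a z))\<^sup>2) \<partial>\<nu>) < ennreal e"
    using M(1) by blast
qed

lemma approximable_scale:
  assumes "approximable f" shows "approximable (\<lambda>z. c * f z)"
  unfolding approximable_def
proof (intro conjI allI impI)
  note [measurable] = assms[unfolded approximable_def, THEN conjunct1]
  show "(\<lambda>z. c * f z) \<in> borel_measurable borel" by measurable
  fix e :: real assume e: "e > 0"
  define C where "C = (cmod c)\<^sup>2 + 1"
  have C: "C > 0" "(cmod c)\<^sup>2 \<le> C" by (auto simp: C_def add_nonneg_pos)
  then obtain K a where K: "finite K" "(\<integral>\<^sup>+z. ennreal ((cmod (f z - laurent K a z))\<^sup>2) \<partial>\<nu>) < ennreal (e/C)"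
    using assms e unfolding approximable_def by (metis divide_pos_pos)
  have "(\<integral>\<^sup>+z. ennreal ((cmod (c * f z - laurent K (\<lambda>k. c * a k) z))\<^sup>2) \<partial>\<nu>)
      \<le> (\<integral>\<^sup>+z. ennreal C * ennreal ((cmod (f z - laurent K a z))\<^sup>2) \<partial>\<nu>)"
  proof (intro nn_integral_mono)
    fix z
    have "cmod (c * f z - laurent K (\<lambda>k. c * a k) z) = cmod c * cmod (f z - laurent K a z)"
      by (simp flip: norm_mult laurent_scale add: algebra_simps)
    then show "ennreal ((cmod (c * f z - laurent K (\<lambda>k. c * a k) z))\<^sup>2)
        \<le> ennreal C * ennreal ((cmod (f z - laurent K a z))\<^sup>2)"
      using C by (simp add: power_mult_distrib mult_right_mono flip: ennreal_mult')
  qed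
  also have "\<dots> = ennreal C * (\<integral>\<^sup>+z. ennreal ((cmod (f z - laurent K a z))\<^sup>2) \<partial>\<nu>)"
    by (simp add: nn_integral_cmult)
  also have "\<dots> < ennreal C * ennreal (e/C)"
    using K(2) C by (intro ennreal_mult_strict_left_mono) auto
  also have "\<dots> = ennreal e" using C e by (simp flip: ennreal_mult')
  finally show "\<exists>K a. finite K \<and> (\<integral>\<^sup>+z. ennreal ((cmod (c * f z - laurent K a z))\<^sup>2) \<partial>\<nu>) < ennreal e"
    using K(1) by blast
qed

text \<open>Dominated convergence makes the squared error between \<open>f\<close> and some
  \<open>F n\<close> small. The majorant bounds the error itself, which is the form available for
  indicators (constant 2) and for simple functions (3 times the modulus of the limit).\<close>

lemma approximable_limit:
  assumes F: "\<And>n::nat. approximable (F n)" and f [measurable]: "f \<in> borel_measurable borel"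
    and lim: "\<And>z. (\<lambda>n. F n z) \<longlonglongrightarrow> f z"
    and dom: "\<And>n z. cmod (f z - F n z) \<le> g z" and [measurable]: "g \<in> borel_measurable borel"
    and fin: "(\<integral>\<^sup>+z. ennreal ((g z)\<^sup>2) \<partial>\<nu>) < \<infinity>"
  shows "approximable f"
  unfolding approximable_def
proof (intro conjI allI impI f)
  have [measurable]: "F n \<in> borel_measurable borel" for n using F by (simp add: approximable_def)
  fix e :: real assume "e > 0"
  then have e: "e / 4 > 0" by simp
  have "(\<lambda>n. \<integral>\<^sup>+z. ennreal ((cmod (f z - F n z))\<^sup>2) \<partial>\<nu>) \<longlonglongrightarrow> (\<integral>\<^sup>+z. 0 \<partial>\<nu>)"
  proof (rule nn_integral_dominated_convergence[where w = "\<lambda>z. ennreal ((g z)\<^sup>2)"])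
    show "AE z in \<nu>. ennreal ((cmod (f z - F j z))\<^sup>2) \<le> ennreal ((g z)\<^sup>2)" for j
      using dom by (auto intro!: ennreal_leI power_mono)
    show "AE z in \<nu>. (\<lambda>n. ennreal ((cmod (f z - F n z))\<^sup>2)) \<longlonglongrightarrow> 0"
    proof (rule AE_I2)
      fix z
      have "(\<lambda>n. (cmod (f z - F n z))\<^sup>2) \<longlonglongrightarrow> (cmod (f z - f z))\<^sup>2"
        by (intro tendsto_intros lim)
      then show "(\<lambda>n. ennreal ((cmod (f z - F n z))\<^sup>2)) \<longlonglongrightarrow> 0"
        by (auto simp flip: ennreal_0 intro!: tendsto_ennrealI)
    qed
  qed (use fin in auto)
  then have "\<forall>\<^sub>F n in sequentially. (\<integral>\<^sup>+z. ennreal ((cmod (f z - F n z))\<^sup>2) \<partial>\<nu>) < ennreal (e/4)"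
    using e by (intro order_tendstoD) (auto simp: ennreal_zero_less_divide)
  then obtain n where n: "(\<integral>\<^sup>+z. ennreal ((cmod (f z - F n z))\<^sup>2) \<partial>\<nu>) < ennreal (e/4)"
    by (auto dest: eventually_happens)
  obtain K a where K: "finite K" "(\<integral>\<^sup>+z. ennreal ((cmod (F n z - laurent K a z))\<^sup>2) \<partial>\<nu>) < ennreal (e/4)"
    using F[of n] e unfolding approximable_def by blast
  have "(\<integral>\<^sup>+z. ennreal ((cmod (f z - laurent K a z))\<^sup>2) \<partial>\<nu>)
      \<le> (\<integral>\<^sup>+z. 2 * ennreal ((cmod (f z - F n z))\<^sup>2) + 2 * ennreal ((cmod (F n z - laurent K a z))\<^sup>2) \<partial>\<nu>)"
  proof (intro nn_integral_mono)
    fix z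
    have "(cmod (f z - laurent K a z))\<^sup>2 \<le> 2 * (cmod (f z - F n z))\<^sup>2 + 2 * (cmod (F n z - laurent K a z))\<^sup>2"
      using cmod_add_sq_le[of "f z - F n z" "F n z - laurent K a z"] by simp
    then show "ennreal ((cmod (f z - laurent K a z))\<^sup>2)
        \<le> 2 * ennreal ((cmod (f z - F n z))\<^sup>2) + 2 * ennreal ((cmod (F n z - laurent K a z))\<^sup>2)"
      by (simp flip: ennreal_plus ennreal_mult' ennreal_numeral)
  qed
  also have "\<dots> = 2 * (\<integral>\<^sup>+z. ennreal ((cmod (f z - F n z))\<^sup>2) \<partial>\<nu>)
      + 2 * (\<integral>\<^sup>+z. ennreal ((cmod (F n z - laurent K a z))\<^sup>2) \<partial>\<nu>)"
    by (simp add: nn_integral_add nn_integral_cmult)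
  also have "\<dots> < 2 * ennreal (e/4) + 2 * ennreal (e/4)"
    using n K(2) by (intro ennreal_add_strict_mono ennreal_mult_strict_left_mono) auto
  also have "\<dots> = ennreal e" using \<open>e > 0\<close> by (simp flip: ennreal_plus ennreal_mult' ennreal_numeral)
  finally show "\<exists>K a. finite K \<and> (\<integral>\<^sup>+z. ennreal ((cmod (f z - laurent K a z))\<^sup>2) \<partial>\<nu>) < ennreal e"
    using K(1) by blast
qed

lemma approximable_continuous:
  assumes "continuous_on UNIV f" shows "approximable f"
  unfolding approximable_def
proof (intro conjI allI impI)
  show [measurable]: "f \<in> borel_measurable borel"
    by (rule borel_measurable_continuous_onI[OF assms])
  fix e :: real assume e: "e > 0"
  \<comment> \<open>The added 1 keeps M positive and makes e / M times the total mass strictly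
    smaller than e, so a uniform error sqrt (e / M) from Stone-Weierstrass suffices.\<close>
  define M where "M = measure \<nu> UNIV + 1"
  have M: "M > 0" by (simp add: M_def add_nonneg_pos)
  have "sqrt (e / M) > 0" using e M by simp
  then obtain p where p: "polynomial_function p" "\<And>z. z \<in> sphere 0 1 \<Longrightarrow> cmod (f z - p z) < sqrt (e / M)"
    using Stone_Weierstrass_polynomial_function[of "sphere 0 1" f "sqrt (e / M)"]
      continuous_on_subset[OF assms] by auto
  then obtain K a where K: "finite K" "\<And>z. cmod z = 1 \<Longrightarrow> p z = laurent K a z"
    using laurent_on_circle_polynomial[OF p(1)] by (auto simp: laurent_on_circle_def)
  have "(\<integral>\<^sup>+z. ennreal ((cmod (f z - laurent K a z))\<^sup>2) \<partial>\<nu>) \<le> (\<integral>\<^sup>+z. ennreal (e / M) \<partial>\<nu>)"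
  proof (intro nn_integral_mono_AE)
    show "AE z in \<nu>. ennreal ((cmod (f z - laurent K a z))\<^sup>2) \<le> ennreal (e / M)"
      using AE_circle
    proof eventually_elim
      case (elim z)
      then have "(cmod (f z - laurent K a z))\<^sup>2 \<le> (sqrt (e / M))\<^sup>2"
        using p(2)[of z] K(2)[of z] by (intro power_mono) auto
      then show ?case using e M by (intro ennreal_leI) simp
    qed
  qed
  also have "\<dots> = ennreal (e / M) * ennreal (measure \<nu> UNIV)"
    using emeasure_eq_measure[of UNIV] by (simp add: space_nu)
  also have "\<dots> = ennreal (e / M * measure \<nu> UNIV)" using e M by (simp flip: ennreal_mult')
  also have "\<dots> < ennreal e"
    using e M by (intro ennreal_lessI) (auto simp: field_simps M_def)
  finally show "\<exists>K a. finite K \<and> (\<integral>\<^sup>+z. ennreal ((cmod (f z - laurent K a z))\<^sup>2) \<partial>\<nu>) < ennreal e"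
    using K(1) by blast
qed

text \<open>The continuous tents max 0 (1 - n dist (z, S)) decrease to the indicator. The empty set
  is separate because \<open>infdist\<close> to it is 0 by convention.\<close>

lemma approximable_indicator_closed:
  assumes "closed S" shows "approximable (\<lambda>z. indicator S z)"
proof (cases "S = {}")
  case True
  then show ?thesis using approximable_continuous[of "\<lambda>_. 0"] by simp
next
  case False
  define F where "F n z = complex_of_real (max 0 (1 - real n * infdist z S))" for n z
  have F01: "0 \<le> max 0 (1 - real n * infdist z S)" "max 0 (1 - real n * infdist z S) \<le> 1" for n z
    by (auto simp: infdist_nonneg)
  show ?thesis
  proof (rule approximable_limit[where F = F and g = "\<lambda>_. 2"])
    show "approximable (F n)" for n
      unfolding F_def by (intro approximable_continuous continuous_intros)
    show "(\<lambda>z. indicator S z :: complex) \<in> borel_measurable borel"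
      using assms by (intro borel_measurable_indicator) auto
    show "(\<lambda>n. F n z) \<longlonglongrightarrow> indicator S z" for z
    proof (cases "z \<in> S")
      case True
      then show ?thesis by (simp add: F_def)
    next
      case z: False
      then have pos: "infdist z S > 0"
        using assms False by (metis closure_closed in_closure_iff_infdist_zero infdist_nonneg order_less_le)
      obtain N :: nat where N: "1 / infdist z S < real N" using reals_Archimedean2 by blast
      have "F n z = 0" if "n \<ge> N" for n
      proof -
        have "1 / infdist z S \<le> real n" using N that by linarith
        then show ?thesis using pos by (simp add: F_def field_simps)
      qed
      then have "\<forall>\<^sub>F n in sequentially. F n z = 0" by (auto simp: eventually_sequentially)
      then show ?thesis using z by (simp add: tendsto_eventually)
    qed
    show "cmod (indicator S z - F n z) \<le> 2" for n z
    proof -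
      have "cmod (F n z) \<le> 1" using F01[of n z] unfolding F_def norm_of_real by simp
      moreover have "cmod (indicator S z) \<le> 1" by (simp add: indicator_def)
      ultimately show ?thesis using norm_triangle_ineq4[of "indicator S z" "F n z"] by linarith
    qed
    show "(\<integral>\<^sup>+z. ennreal (2\<^sup>2) \<partial>\<nu>) < \<infinity>"
      by (rule constant_finite)
  qed simp
qed

text \<open>A pi-lambda argument: closed sets are stable under intersection and generate the Borel
  sets, and approximability survives complements and countable disjoint unions.\<close>

lemma approximable_indicator:
  assumes "S \<in> sets borel" shows "approximable (\<lambda>z. indicator S z)"
proof -
  have eq: "sets (borel :: complex measure) = sigma_sets UNIV {S. closed S}"
    by (subst borel_eq_closed) simp
  have "Int_stable {S :: complex set. closed S}" by (auto simp: Int_stable_def)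
  moreover have "{S :: complex set. closed S} \<subseteq> Pow UNIV" by simp
  moreover have "S \<in> sigma_sets UNIV {S. closed S}" using assms eq by simp
  ultimately show ?thesis
  proof (induction rule: sigma_sets_induct_disjoint)
    case (basic A)
    then show ?case by (simp add: approximable_indicator_closed)
  next
    case empty
    show ?case by (rule approximable_indicator_closed) simp
  next
    case (compl A)
    have "approximable (\<lambda>z. 1 + -1 * indicator A z)"
      by (intro approximable_add approximable_scale compl approximable_continuous continuous_intros)
    moreover have "(\<lambda>z. 1 + -1 * indicator A z) = (\<lambda>z. indicator (UNIV - A) z :: complex)"
      by (auto simp: indicator_def)
    ultimately show ?case by simp
  next
    case (union A)
    have A: "A i \<in> sets borel" for i using union(2) eq by auto
    have fin: "approximable (\<lambda>z. \<Sum>i<n. indicator (A i) z)" for n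
    proof (induction n)
      case 0
      show ?case using approximable_continuous[of "\<lambda>_. 0"] by simp
    next
      case (Suc n)
      then show ?case using approximable_add[OF Suc union(3)[of n]] by simp
    qed
    have ind: "(\<Sum>i<n. indicator (A i) z) = (indicator (\<Union>i<n. A i) z :: complex)" for n z
      using union(1) by (subst indicator_UN_disjoint) (auto intro: disjoint_family_on_mono)
    show ?case
    proof (rule approximable_limit[OF fin, where g = "\<lambda>_. 2"])
      show "(\<lambda>z. indicator (\<Union>i. A i) z :: complex) \<in> borel_measurable borel"
        using A by (intro borel_measurable_indicator) auto
      show "(\<lambda>n. \<Sum>i<n. indicator (A i) z :: complex) \<longlonglongrightarrow> indicator (\<Union>i. A i) z" for z
        unfolding ind by (rule LIMSEQ_indicator_UN)
      show "cmod (indicator (\<Union>i. A i) z - (\<Sum>i<n. indicator (A i) z)) \<le> 2" for n z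
        unfolding ind by (auto simp: indicator_def)
      show "(\<integral>\<^sup>+z. ennreal (2\<^sup>2) \<partial>\<nu>) < \<infinity>"
        by (rule constant_finite)
    qed simp
  qed
qed

text \<open>Simple functions with |F i| \<le> 2 |f| converge pointwise to f; the error is at most 3
  |f|, which is square integrable.\<close>

theorem laurent_dense:
  assumes f [measurable]: "f \<in> borel_measurable borel"
    and fin: "(\<integral>\<^sup>+z. ennreal ((cmod (f z))\<^sup>2) \<partial>\<nu>) < \<infinity>"
    and e: "e > 0"
  obtains K a where "finite K" "(\<integral>\<^sup>+z. ennreal ((cmod (f z - laurent K a z))\<^sup>2) \<partial>\<nu>) < ennreal e"
proof -
  obtain F where F: "\<And>i. simple_function borel (F i)" "\<And>z. (\<lambda>i. F i z) \<longlonglongrightarrow> f z"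
    "\<And>i z. cmod (F i z) \<le> 2 * cmod (f z)"
    using borel_measurable_implies_sequence_metric[OF f, of 0] by auto
  have simple: "approximable (F i)" for i
  proof -
    have fin: "finite (range (F i))" and vim: "F i -` {y} \<in> sets borel" for y
      using F(1)[of i] by (auto simp: simple_function_def)
        (metis (no_types) Int_UNIV_right borel_singleton measurable_sets space_borel
          borel_measurable_simple_function[OF F(1)] sets.empty_sets singletonI sets.insert_in_sets)
    have "F i = (\<lambda>z. \<Sum>y\<in>range (F i). y * indicator (F i -` {y}) z)"
    proof
      fix z
      have "(\<Sum>y\<in>range (F i). y * indicator (F i -` {y}) z) = (\<Sum>y\<in>{F i z}. y * indicator (F i -` {y}) z)"
        using fin by (intro sum.mono_neutral_right) (auto simp: indicator_def)
      then show "F i z = (\<Sum>y\<in>range (F i). y * indicator (F i -` {y}) z)" by simp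
    qed
    moreover have "approximable (\<lambda>z. \<Sum>y\<in>Y. y * indicator (F i -` {y}) z)" if "finite Y" for Y
      using that
    proof (induction Y)
      case empty
      show ?case using approximable_continuous[of "\<lambda>_. 0"] by simp
    next
      case (insert y Y)
      then show ?case
        using approximable_add[OF approximable_scale[OF approximable_indicator[OF vim]] insert(3)]
        by (simp only: sum.insert[OF insert(1,2)])
    qed
    ultimately show ?thesis using fin by metis
  qed
  have "approximable f"
  proof (rule approximable_limit[OF simple f F(2)])
    show "cmod (f z - F n z) \<le> 3 * cmod (f z)" for n z
      using norm_triangle_ineq4[of "f z" "F n z"] F(3)[of n z] by linarith
    have "(\<integral>\<^sup>+z. ennreal ((3 * cmod (f z))\<^sup>2) \<partial>\<nu>) = 9 * (\<integral>\<^sup>+z. ennreal ((cmod (f z))\<^sup>2) \<partial>\<nu>)"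
      by (subst nn_integral_cmult[symmetric]) (auto simp: power_mult_distrib ennreal_mult')
    then show "(\<integral>\<^sup>+z. ennreal ((3 * cmod (f z))\<^sup>2) \<partial>\<nu>) < \<infinity>"
      using fin by (simp add: ennreal_mult_less_top)
  qed simp
  then show thesis using that e unfolding approximable_def by blast
qed

end

section \<open>Fourier series and the Plancherel identity for bounded support\<close>

text \<open>\<open>Arg\<close> is continuous off the nonpositive real axis, equals pi on its
  negative part and is 0 at the origin by convention; measurability is glued from these
  pieces.\<close>

lemma borel_measurable_Arg [measurable]: "Arg \<in> borel_measurable borel"
proof -
  have [measurable]: "(\<real>\<^sub>\<le>\<^sub>0 :: complex set) \<in> sets borel"
    using closed_nonpos_Reals_complex by simp
  have [measurable]: "(\<lambda>z. if z \<in> \<real>\<^sub>\<le>\<^sub>0 then 0 else Arg z) \<in> borel_measurable borel"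
    by (intro borel_measurable_continuous_on_if continuous_intros continuous_on_Arg) auto
  have "Arg z = (if z \<in> \<real>\<^sub>\<le>\<^sub>0 - {0} then pi else (if z \<in> \<real>\<^sub>\<le>\<^sub>0 then 0 else Arg z))" for z
  proof (cases "z = 0")
    case False
    then show ?thesis
      by (auto simp: Arg_eq_pi_iff complex_nonpos_Reals_iff complex_is_Real_iff complex_eq_iff)
  qed (simp add: Arg_zero)
  then have "Arg = (\<lambda>z. if z \<in> \<real>\<^sub>\<le>\<^sub>0 - {0} then pi else (if z \<in> \<real>\<^sub>\<le>\<^sub>0 then 0 else Arg z))" by blast
  also have "\<dots> \<in> borel_measurable borel" by measurable
  finally show ?thesis .
qed

text \<open>Pushforward to the circle composes functions with Borel maps, which Lebesgue
  measurability does not support; the functions are replaced by Borel ones first.\<close>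

lemma complex_borel_representative:
  fixes f :: "real \<Rightarrow> complex"
  assumes "f \<in> borel_measurable lebesgue"
  obtains g where "g \<in> borel_measurable borel" "AE x in lebesgue. f x = g x"
proof -
  have "(\<lambda>x. Re (f x)) \<in> borel_measurable (completion lborel)" "(\<lambda>x. Im (f x)) \<in> borel_measurable (completion lborel)"
    using assms by measurable
  then obtain u v where uv [measurable]: "u \<in> borel_measurable lborel" "v \<in> borel_measurable lborel"
    and ae: "AE x in lborel. Re (f x) = u x" "AE x in lborel. Im (f x) = v x"
    using completion_ex_borel_measurable_real by blast
  show thesis
  proof
    show "(\<lambda>x. Complex (u x) (v x)) \<in> borel_measurable borel"
      unfolding Complex_eq using uv by measurable
    show "AE x in lebesgue. f x = Complex (u x) (v x)"
      using ae[THEN AE_completion] by eventually_elim (simp add: complex_eq_iff)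
  qed
qed

text \<open>Each x lies in exactly one translate of [0, p), the one of index floor (x / p).
  \<open>int_decode\<close> enumerates the integers so that the sum runs over the naturals.\<close>

lemma nn_integral_periodize:
  fixes g :: "real \<Rightarrow> ennreal"
  assumes g [measurable]: "g \<in> borel_measurable lebesgue" and p: "p > 0"
  shows "(\<integral>\<^sup>+x. g x \<partial>lebesgue)
    = (\<integral>\<^sup>+x. indicator {0..<p} x * (\<Sum>n. g (x + p * of_int (int_decode n))) \<partial>lebesgue)"
proof -
  let ?k = "\<lambda>n. p * of_int (int_decode n) :: real"
  have one: "(\<Sum>n. indicator {0..<p} (x - ?k n)) = (1 :: ennreal)" for x
  proof -
    have iff: "x - p * of_int k \<in> {0..<p} \<longleftrightarrow> k = \<lfloor>x / p\<rfloor>" for k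
      using p floor_eq_iff[of "x / p" k] by (auto simp: field_simps)
    have "(\<lambda>n. indicator {0..<p} (x - ?k n)) = (\<lambda>n. if n = int_encode \<lfloor>x / p\<rfloor> then (1::ennreal) else 0)"
    proof
      fix n
      have "int_decode n = \<lfloor>x / p\<rfloor> \<longleftrightarrow> n = int_encode \<lfloor>x / p\<rfloor>" by (metis int_encode_inverse int_decode_inverse)
      then show "indicator {0..<p} (x - ?k n) = (if n = int_encode \<lfloor>x / p\<rfloor> then (1::ennreal) else 0)"
        unfolding indicator_def iff by simp
    qed
    moreover have "\<dots> sums 1" by (rule sums_single)
    ultimately show ?thesis by (simp add: sums_iff)
  qed
  have meas: "(\<lambda>x. g (x + c)) \<in> borel_measurable lebesgue" for c
  proof -
    have "(\<lambda>x. c + 1 * x) \<in> lebesgue \<rightarrow>\<^sub>M lebesgue"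
      using lebesgue_affine_measurable[of "\<lambda>_. 1" c] by simp
    from measurable_compose[OF this g] show ?thesis by (simp add: add.commute)
  qed
  have meas': "(\<lambda>x. indicator {0..<p} (x - c) :: ennreal) \<in> borel_measurable lebesgue" for c
  proof -
    have "(\<lambda>x. indicator {0..<p} (x - c) :: ennreal) \<in> borel_measurable borel" by measurable
    then show ?thesis by (intro measurable_completion) simp
  qed
  have "(\<integral>\<^sup>+x. g x \<partial>lebesgue) = (\<integral>\<^sup>+x. (\<Sum>n. g x * indicator {0..<p} (x - ?k n)) \<partial>lebesgue)"
    by (simp add: one)
  also have "\<dots> = (\<Sum>n. \<integral>\<^sup>+x. g x * indicator {0..<p} (x - ?k n) \<partial>lebesgue)"
    using meas' by (intro nn_integral_suminf) auto
  also have "\<dots> = (\<Sum>n. \<integral>\<^sup>+x. indicator {0..<p} x * g (x + ?k n) \<partial>lebesgue)"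
  proof (intro suminf_cong)
    fix n
    have "(\<integral>\<^sup>+x. g x * indicator {0..<p} (x - ?k n) \<partial>lebesgue)
        = ennreal \<bar>1\<bar> * (\<integral>\<^sup>+x. g (?k n + 1 * x) * indicator {0..<p} (?k n + 1 * x - ?k n) \<partial>lebesgue)"
      using meas' by (intro nn_integral_real_affine_lebesgue) auto
    then show "(\<integral>\<^sup>+x. g x * indicator {0..<p} (x - ?k n) \<partial>lebesgue)
        = (\<integral>\<^sup>+x. indicator {0..<p} x * g (x + ?k n) \<partial>lebesgue)"
      by (simp add: add.commute mult.commute)
  qed
  also have "\<dots> = (\<integral>\<^sup>+x. (\<Sum>n. indicator {0..<p} x * g (x + ?k n)) \<partial>lebesgue)"
    using meas meas'[of 0] by (intro nn_integral_suminf[symmetric] borel_measurable_times) auto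
  finally show ?thesis by simp
qed

lemma L2_inner_sum_left:
  assumes "\<And>i. i \<in> I \<Longrightarrow> f i \<in> L2" "g \<in> L2"
  shows "L2_inner (\<lambda>x. \<Sum>i\<in>I. f i x) g = (\<Sum>i\<in>I. L2_inner (f i) g)"
  using assms(1)
proof (induction I rule: infinite_finite_induct)
  case (insert i I)
  then show ?case using assms(2) by (simp add: L2_inner_add_left L2_sum)
qed (auto simp: L2_inner_def)

text \<open>Completing the square. The identity serves both halves of Parseval: optimal coefficients
  kill the last sum (Bessel), and for arbitrary ones that sum may be dropped as nonnegative.
  \<open>N\<close> is the common squared norm, so the system stays unnormalized.\<close>

lemma L2_orthogonal_expansion:
  assumes h: "h \<in> L2" and e: "\<And>k. e k \<in> L2" and N: "N > 0"
    and orth: "\<And>k l. L2_inner (e k) (e l) = (if k = l then of_real N else 0)" and K: "finite K"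
  shows "(L2_norm (\<lambda>x. h x - (\<Sum>k\<in>K. a k * e k x)))\<^sup>2
    = (L2_norm h)\<^sup>2 - (\<Sum>k\<in>K. (cmod (L2_inner h (e k)))\<^sup>2) / N
      + (\<Sum>k\<in>K. (cmod (L2_inner h (e k) - of_real N * a k))\<^sup>2) / N"
proof -
  define P where "P = (\<lambda>x. \<Sum>k\<in>K. a k * e k x)"
  define c where "c k = L2_inner h (e k)" for k
  have ae: "(\<lambda>x. a k * e k x) \<in> L2" for k by (rule L2_scale[OF e])
  have P: "P \<in> L2" unfolding P_def by (rule L2_sum[OF ae])
  have Pg: "L2_inner P g = (\<Sum>k\<in>K. a k * L2_inner (e k) g)" if "g \<in> L2" for g
    unfolding P_def by (simp add: L2_inner_sum_left[OF ae that] L2_inner_scale_left)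
  have "L2_inner h P = cnj (L2_inner P h)" by (rule L2_inner_commute)
  also have "\<dots> = (\<Sum>k\<in>K. cnj (a k) * c k)"
    unfolding Pg[OF h] c_def cnj_sum complex_cnj_mult by (simp flip: L2_inner_commute)
  finally have hP: "L2_inner h P = (\<Sum>k\<in>K. cnj (a k) * c k)" .
  have eP: "L2_inner (e k) P = cnj (a k) * of_real N" if "k \<in> K" for k
  proof -
    have "L2_inner P (e k) = (\<Sum>l\<in>K. if l = k then a l * of_real N else 0)"
      unfolding Pg[OF e] by (intro sum.cong) (auto simp: orth)
    also have "\<dots> = a k * of_real N" using that K by simp
    finally show ?thesis by (subst L2_inner_commute) simp
  qed
  have "complex_of_real ((L2_norm P)\<^sup>2) = (\<Sum>k\<in>K. complex_of_real (N * (cmod (a k))\<^sup>2))"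
    unfolding L2_inner_self[symmetric] Pg[OF P]
  proof (intro sum.cong refl)
    fix k assume "k \<in> K"
    have "a k * cnj (a k) = complex_of_real ((cmod (a k))\<^sup>2)" by (rule complex_norm_square[symmetric])
    then show "a k * L2_inner (e k) P = complex_of_real (N * (cmod (a k))\<^sup>2)"
      unfolding eP[OF \<open>k \<in> K\<close>] of_real_mult by (simp only: mult.assoc[symmetric]) (simp only: mult.commute)
  qed
  then have PP: "(L2_norm P)\<^sup>2 = (\<Sum>k\<in>K. N * (cmod (a k))\<^sup>2)"
    unfolding of_real_sum[symmetric] of_real_eq_iff .
  have sq: "(cmod (c k - of_real N * a k))\<^sup>2 = (cmod (c k))\<^sup>2 - 2 * N * Re (cnj (a k) * c k) + N * (N * (cmod (a k))\<^sup>2)" for k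
    unfolding cmod_power2 by (simp add: power2_eq_square algebra_simps)
  have hm: "L2_inner h (\<lambda>x. -1 * P x) = - L2_inner h P"
    by (subst (1 2) L2_inner_commute) (simp only: L2_inner_scale_left, simp)
  have "(L2_norm (\<lambda>x. h x - P x))\<^sup>2 = (L2_norm h)\<^sup>2 - 2 * Re (L2_inner h P) + (L2_norm P)\<^sup>2"
    using L2_norm_add_sq[OF h L2_scale[OF P, of "-1"]] L2_norm_scale[of "-1" P]
    by (simp add: hm[simplified])
  also have "\<dots> = (L2_norm h)\<^sup>2 - (\<Sum>k\<in>K. (cmod (c k))\<^sup>2) / N + (\<Sum>k\<in>K. (cmod (c k - of_real N * a k))\<^sup>2) / N"
    unfolding hP PP sq using N
    by (simp add: sum.distrib sum_subtractf Re_sum add_divide_distrib diff_divide_distrib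
        mult.assoc flip: sum_distrib_left)
  finally show ?thesis unfolding P_def c_def .
qed

definition fourier_mode :: "real \<Rightarrow> int \<Rightarrow> real \<Rightarrow> complex" where
  "fourier_mode R k x = indicator {-R..R} x * exp (\<i> * of_real (pi * of_int k / R * x))"

lemma fourier_mode_L2: "fourier_mode R k \<in> L2"
proof -
  have "(\<lambda>x. indicator {-R..R} x :: complex) \<in> L2"
  proof -
    have "emeasure lebesgue {-R..R} < \<infinity>" by (cases "R \<ge> 0") auto
    then have "integrable lebesgue (indicat_real {-R..R})"
      by (intro integrable_real_indicator) auto
    moreover have "(\<lambda>x. (cmod (indicator {-R..R} x))\<^sup>2) = indicat_real {-R..R}"
      by (auto simp: indicator_def)
    moreover have "(\<lambda>x. indicator {-R..R} x :: complex) \<in> borel_measurable lebesgue"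
      by (intro borel_measurable_indicator) auto
    ultimately show ?thesis by (simp add: L2_def)
  qed
  moreover have "(\<lambda>x. exp (\<i> * of_real (pi * of_int k / R * x))) \<in> borel_measurable lebesgue"
    by (intro measurable_completion) (simp, measurable)
  ultimately show ?thesis
    using L2_mult_bounded[of "\<lambda>x. indicator {-R..R} x" "\<lambda>x. exp (\<i> * of_real (pi * of_int k / R * x))" 1]
    unfolding fourier_mode_def[abs_def] by (simp add: mult.commute norm_exp_i_times)
qed

lemma fourier_mode_orthogonal:
  assumes R: "R > 0"
  shows "L2_inner (fourier_mode R k) (fourier_mode R l) = (if k = l then of_real (2 * R) else 0)"
proof -
  define w where "w = pi * of_int (k - l) / R"
  let ?f = "\<lambda>x. exp (\<i> * of_real (w * x))"
  have fm: "fourier_mode R k x * cnj (fourier_mode R l x) = indicator {-R..R} x *\<^sub>R ?f x" for x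
  proof -
    have "exp (\<i> * of_real (pi * of_int k / R * x)) * exp (- (\<i> * of_real (pi * of_int l / R * x))) = ?f x"
      unfolding exp_add[symmetric] w_def by (simp add: diff_divide_distrib algebra_simps)
    then show ?thesis by (auto simp: fourier_mode_def indicator_def exp_cnj)
  qed
  have "(LINT x|lebesgue. indicator {-R..R} x *\<^sub>R ?f x) = (LINT x|lborel. indicator {-R..R} x *\<^sub>R ?f x)"
    by (intro integral_completion) measurable
  also have "\<dots> = (if k = l then of_real (2 * R) else 0)"
  proof (cases "k = l")
    case True
    then have "w = 0" by (simp add: w_def)
    then show ?thesis using R True by (simp add: scaleR_conv_of_real flip: mult.assoc)
  next
    case False
    then have w: "w \<noteq> 0" using R by (simp add: w_def)
    let ?F = "\<lambda>x. exp (\<i> * of_real (w * x)) / (\<i> * of_real w)"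
    have "has_bochner_integral lborel (\<lambda>x. indicator {-R..R} x *\<^sub>R ?f x) (?F R - ?F (- R))"
    proof (rule has_bochner_integral_FTC_Icc)
      show "(?F has_vector_derivative ?f x) (at x within {-R..R})" for x
        using w by (auto intro!: derivative_eq_intros has_vector_derivative_real_field simp: field_simps)
      show "continuous_on {-R..R} ?f" by (intro continuous_intros)
    qed (use R in auto)
    then have "(LINT x|lborel. indicator {-R..R} x *\<^sub>R ?f x) = ?F R - ?F (- R)"
      by (rule has_bochner_integral_integral_eq)
    \<comment> \<open>The two phases are pi (k - l) and -pi (k - l); they differ by 2 pi (k -
      l).\<close>
    also have "exp (\<i> * of_real (w * R)) = exp (\<i> * of_real (w * (- R)))"
      unfolding exp_eq
      using R by (intro exI[of _ "k - l"]) (simp add: w_def field_simps)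
    then have "?F R - ?F (- R) = 0" by simp
    finally show ?thesis using False by simp
  qed
  finally show ?thesis by (simp add: L2_inner_def fm)
qed

text \<open>Completeness of the modes, read off from \<open>laurent_dense\<close>: on the circle the
  mode of index k is z^k for z = cis (pi x / R).\<close>

lemma fourier_mode_approx:
  assumes R: "R > 0" and h: "h \<in> L2" and supp: "\<And>x. x \<notin> {-R..R} \<Longrightarrow> h x = 0" and e: "e > 0"
  obtains K a where "finite K" "(L2_norm (\<lambda>x. h x - (\<Sum>k\<in>K. a k * fourier_mode R k x)))\<^sup>2 < e"
proof -
  obtain h' where h' [measurable]: "h' \<in> borel_measurable borel" and hh': "AE x in lebesgue. h x = h' x"
    using complex_borel_representative[OF L2_measurable[OF h]] by blast
  define \<mu> where "\<mu> = density lborel (indicator {-R..R} :: real \<Rightarrow> ennreal)"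
  define \<phi> where "\<phi> x = cis (pi / R * x)" for x
  have cis: "cis \<in> borel_measurable borel"
    by (intro borel_measurable_continuous_onI continuous_intros)
  have \<phi> [measurable]: "\<phi> \<in> borel_measurable borel"
    unfolding \<phi>_def by (intro measurable_compose[OF _ cis]) measurable
  define \<nu> where "\<nu> = distr \<mu> borel \<phi>"
  have em: "emeasure \<mu> UNIV = ennreal (2 * R)"
    using R by (simp add: \<mu>_def emeasure_density)
  have sets_\<mu> [measurable_cong, simp]: "sets \<mu> = sets borel" by (simp add: \<mu>_def)
  have sp [simp]: "space \<mu> = UNIV" by (simp add: \<mu>_def)
  interpret finite_measure \<nu>
    by (rule finite_measureI) (use em in \<open>simp add: \<nu>_def emeasure_distr\<close>)
  interpret circle_measure \<nu>
  proof unfold_locales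
    show "sets \<nu> = sets borel" by (simp add: \<nu>_def)
    show "AE z in \<nu>. cmod z = 1" unfolding \<nu>_def by (subst AE_distr_iff) (auto simp: \<phi>_def)
  qed
  \<comment> \<open>\<open>Arg\<close> has values in (-pi, pi], so this undoes \<phi> on (-R, R].
    The endpoint -R has the same image as R and is discarded as a null set.\<close>
  define f where "f z = h' (R / pi * Arg z)" for z
  have f [measurable]: "f \<in> borel_measurable borel" unfolding f_def by measurable
  have f\<phi>: "f (\<phi> x) = h' x" if "x \<in> {-R<..R}" for x
  proof -
    have "pi / R * x \<in> {-pi<..pi}"
    proof -
      have "pi * (- R) < pi * x" "pi * x \<le> pi * R"
        using that by (intro mult_strict_left_mono mult_left_mono; simp)+
      then show ?thesis using R by (simp add: field_simps)
    qed
    then show ?thesis using R by (simp add: f_def \<phi>_def Arg_cis)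
  qed
  have hint: "h x = indicator {-R..R} x * h x" for x using supp[of x] by (auto simp: indicator_def)
  have transfer: "(\<integral>\<^sup>+z. ennreal ((cmod (f z - G z))\<^sup>2) \<partial>\<nu>)
      = (\<integral>\<^sup>+x. ennreal ((cmod (h x - indicator {-R..R} x * G (\<phi> x)))\<^sup>2) \<partial>lebesgue)"
    if G [measurable]: "G \<in> borel_measurable borel" for G
  proof -
    have "(\<integral>\<^sup>+z. ennreal ((cmod (f z - G z))\<^sup>2) \<partial>\<nu>)
        = (\<integral>\<^sup>+x. indicator {-R..R} x * ennreal ((cmod (f (\<phi> x) - G (\<phi> x)))\<^sup>2) \<partial>lborel)"
      unfolding \<nu>_def by (subst nn_integral_distr) (auto simp: \<mu>_def nn_integral_density)
    also have "\<dots> = (\<integral>\<^sup>+x. indicator {-R..R} x * ennreal ((cmod (f (\<phi> x) - G (\<phi> x)))\<^sup>2) \<partial>lebesgue)"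
      by (simp add: nn_integral_completion)
    also have "\<dots> = (\<integral>\<^sup>+x. ennreal ((cmod (h x - indicator {-R..R} x * G (\<phi> x)))\<^sup>2) \<partial>lebesgue)"
    proof (intro nn_integral_cong_AE)
      have "AE x in lebesgue. x \<noteq> - R" by (intro AE_completion AE_lborel_singleton)
      with hh' show "AE x in lebesgue. indicator {-R..R} x * ennreal ((cmod (f (\<phi> x) - G (\<phi> x)))\<^sup>2)
          = ennreal ((cmod (h x - indicator {-R..R} x * G (\<phi> x)))\<^sup>2)"
      proof eventually_elim
        case (elim x)
        show ?case
        proof (cases "x \<in> {-R..R}")
          case True
          then show ?thesis using elim f\<phi>[of x] by auto
        next
          case False
          then show ?thesis using supp[OF False] by simp
        qed
      qed
    qed
    finally show ?thesis .
  qed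
  have "(\<integral>\<^sup>+z. ennreal ((cmod (f z))\<^sup>2) \<partial>\<nu>) < \<infinity>"
    using transfer[of "\<lambda>_. 0"] h by (simp add: L2_iff_nn_integral)
  then obtain K a where K: "finite K" "(\<integral>\<^sup>+z. ennreal ((cmod (f z - laurent K a z))\<^sup>2) \<partial>\<nu>) < ennreal e"
    using laurent_dense[OF f _ e] by blast
  have mode: "indicator {-R..R} x * laurent K a (\<phi> x) = (\<Sum>k\<in>K. a k * fourier_mode R k x)" for x
  proof -
    have "\<phi> x powi k = exp (\<i> * of_real (pi * of_int k / R * x))" for k
      unfolding \<phi>_def Complex.cis_power_int by (simp add: cis_conv_exp mult_ac)
    then show ?thesis unfolding laurent_def fourier_mode_def by (simp add: sum_distrib_left mult_ac)
  qed
  let ?d = "\<lambda>x. h x - (\<Sum>k\<in>K. a k * fourier_mode R k x)"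
  have "?d \<in> L2" by (intro L2_diff h L2_sum L2_scale fourier_mode_L2)
  then have "ennreal ((L2_norm ?d)\<^sup>2) < ennreal e"
    using K(2) transfer[of "laurent K a"] by (simp add: mode L2_nn_norm)
  then have "(L2_norm ?d)\<^sup>2 < e" using e by (simp add: ennreal_less_iff)
  with K(1) show thesis by (rule that)
qed

lemma fourier_series_Parseval:
  assumes R: "R > 0" and h: "h \<in> L2" and supp: "\<And>x. x \<notin> {-R..R} \<Longrightarrow> h x = 0"
  shows "(\<Sum>n. ennreal ((cmod (L2_inner h (fourier_mode R (int_decode n))))\<^sup>2)) = ennreal (2 * R * (L2_norm h)\<^sup>2)"
proof (rule antisym)
  let ?c = "\<lambda>k. L2_inner h (fourier_mode R k)"
  note expansion = L2_orthogonal_expansion[OF h fourier_mode_L2 _ fourier_mode_orthogonal[OF R]]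
  have le: "(\<Sum>k\<in>K. (cmod (?c k))\<^sup>2) \<le> 2 * R * (L2_norm h)\<^sup>2" if "finite K" for K
  proof -
    \<comment> \<open>The optimal coefficients: the last sum of the expansion vanishes, and
      nonnegativity of the left side is Bessel's inequality.\<close>
    define a where "a k = ?c k / of_real (2 * R)" for k
    have a: "?c k - of_real (2 * R) * a k = 0" for k using R by (simp add: a_def)
    have "(L2_norm (\<lambda>x. h x - (\<Sum>k\<in>K. a k * fourier_mode R k x)))\<^sup>2
        = (L2_norm h)\<^sup>2 - (\<Sum>k\<in>K. (cmod (?c k))\<^sup>2) / (2 * R)
          + (\<Sum>k\<in>K. (cmod (?c k - of_real (2 * R) * a k))\<^sup>2) / (2 * R)"
      by (rule expansion[OF _ that]) (use R in simp)
    then have "(L2_norm h)\<^sup>2 - (\<Sum>k\<in>K. (cmod (?c k))\<^sup>2) / (2 * R)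
        = (L2_norm (\<lambda>x. h x - (\<Sum>k\<in>K. a k * fourier_mode R k x)))\<^sup>2"
      unfolding a by simp
    then have "0 \<le> (L2_norm h)\<^sup>2 - (\<Sum>k\<in>K. (cmod (?c k))\<^sup>2) / (2 * R)"
      by (simp only: zero_le_power2)
    then show ?thesis using R by (simp add: field_simps)
  qed
  have reindex: "(\<Sum>n<N. ennreal ((cmod (?c (int_decode n)))\<^sup>2)) = ennreal (\<Sum>k\<in>int_decode ` {..<N}. (cmod (?c k))\<^sup>2)" for N
    by (subst sum_ennreal) (simp_all add: sum.reindex[OF inj_int_decode])
  show "(\<Sum>n. ennreal ((cmod (?c (int_decode n)))\<^sup>2)) \<le> ennreal (2 * R * (L2_norm h)\<^sup>2)"
    by (intro suminf_le_const[OF summableI]) (simp only: reindex, intro ennreal_leI le finite_imageI finite_lessThan)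
  show "ennreal (2 * R * (L2_norm h)\<^sup>2) \<le> (\<Sum>n. ennreal ((cmod (?c (int_decode n)))\<^sup>2))"
  proof (rule ennreal_le_epsilon)
    fix e :: real assume "e > 0"
    \<comment> \<open>Conversely, an approximation with arbitrary coefficients bounds the norm from
      above by dropping the last sum; multiplying by 2 R turns this error into e.\<close>
    then have "e / (2 * R) > 0" using R by simp
    then obtain K a where K: "finite K" "(L2_norm (\<lambda>x. h x - (\<Sum>k\<in>K. a k * fourier_mode R k x)))\<^sup>2 < e / (2 * R)"
      using fourier_mode_approx[OF R h supp] by blast
    define s where "s = (\<Sum>k\<in>K. (cmod (?c k))\<^sup>2)"
    define t where "t N = (\<Sum>k\<in>int_decode ` {..<N}. (cmod (?c k))\<^sup>2)" for N
    have t0: "0 \<le> t N" for N unfolding t_def by (intro sum_nonneg) simp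
    have "0 \<le> (\<Sum>k\<in>K. (cmod (?c k - of_real (2 * R) * a k))\<^sup>2) / (2 * R)"
      using R by (intro divide_nonneg_nonneg sum_nonneg) auto
    moreover have "(L2_norm (\<lambda>x. h x - (\<Sum>k\<in>K. a k * fourier_mode R k x)))\<^sup>2
        = (L2_norm h)\<^sup>2 - s / (2 * R) + (\<Sum>k\<in>K. (cmod (?c k - of_real (2 * R) * a k))\<^sup>2) / (2 * R)"
      unfolding s_def by (rule expansion[OF _ K(1)]) (use R in simp)
    ultimately have "(L2_norm h)\<^sup>2 < (s + e) / (2 * R)"
      using K(2) by (simp add: add_divide_distrib)
    then have 1: "2 * R * (L2_norm h)\<^sup>2 \<le> s + e"
      using R by (simp add: field_simps)
    have "finite (int_encode ` K)" using K by simp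
    then obtain N where N: "int_encode ` K \<subseteq> {..<N}" unfolding finite_nat_iff_bounded by blast
    have "K \<subseteq> int_decode ` {..<N}"
    proof
      fix k assume "k \<in> K"
      then have "int_encode k \<in> {..<N}" using N by blast
      then show "k \<in> int_decode ` {..<N}" by (metis imageI int_encode_inverse)
    qed
    then have "s \<le> t N" unfolding s_def t_def by (intro sum_mono2) auto
    with 1 have "ennreal (2 * R * (L2_norm h)\<^sup>2) \<le> ennreal (t N + e)" by (intro ennreal_leI) linarith
    also have "\<dots> = ennreal (t N) + ennreal e" using t0 \<open>e > 0\<close> by (intro ennreal_plus) simp_all
    also have "\<dots> \<le> (\<Sum>n. ennreal ((cmod (?c (int_decode n)))\<^sup>2)) + ennreal e"
      unfolding t_def reindex[symmetric] by (intro add_right_mono sum_le_suminf summableI) simp_all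
    finally show "ennreal (2 * R * (L2_norm h)\<^sup>2) \<le> (\<Sum>n. ennreal ((cmod (?c (int_decode n)))\<^sup>2)) + ennreal e" .
  qed
qed

section \<open>Fourier integrals of functions with bounded support\<close>

definition fourier_integral :: "(real \<Rightarrow> complex) \<Rightarrow> real \<Rightarrow> complex" where
  "fourier_integral h \<xi> = complex_of_real (1 / sqrt (2 * pi)) *
     (LINT x|lebesgue. h x * exp (- (\<i> * complex_of_real (x * \<xi>))))"

text \<open>The mode of index 0 is the indicator of [-R, R], so \<open>h\<close> is a product of two
  L2 functions.\<close>

lemma integrable_bounded_support:
  assumes h: "h \<in> L2" and supp: "\<And>x. x \<notin> {-R..R} \<Longrightarrow> h x = 0"
  shows "integrable lebesgue h"
proof -
  have "integrable lebesgue (\<lambda>x. h x * cnj (fourier_mode R 0 x))"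
    by (rule L2_inner_integrable[OF h fourier_mode_L2])
  moreover have "(\<lambda>x. h x * cnj (fourier_mode R 0 x)) = h"
  proof
    fix x
    show "h x * cnj (fourier_mode R 0 x) = h x"
      using supp[of x] by (cases "x \<in> {-R..R}") (simp_all add: fourier_mode_def)
  qed
  ultimately show ?thesis by simp
qed

lemma borel_measurable_modulation [measurable]:
  "(\<lambda>x. exp (- (\<i> * complex_of_real (x * \<xi>)))) \<in> borel_measurable lebesgue"
  by (intro measurable_completion) (simp, measurable)

text \<open>Used for measurability of the transform; dominated convergence with majorant
  |h|.\<close>

lemma fourier_integral_continuous:
  assumes h: "integrable lebesgue h"
  shows "continuous_on UNIV (fourier_integral h)"
  unfolding continuous_on_sequentially
proof (intro ballI allI impI, elim conjE)
  fix u :: "nat \<Rightarrow> real" and \<xi> assume u: "u \<longlonglongrightarrow> \<xi>"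
  have "(\<lambda>n. LINT x|lebesgue. h x * exp (- (\<i> * complex_of_real (x * u n))))
      \<longlonglongrightarrow> (LINT x|lebesgue. h x * exp (- (\<i> * complex_of_real (x * \<xi>))))"
  proof (rule integral_dominated_convergence[where w = "\<lambda>x. cmod (h x)"])
    have M: "(\<lambda>x. h x * exp (- (\<i> * complex_of_real (x * \<eta>)))) \<in> borel_measurable lebesgue" for \<eta>
      by (intro borel_measurable_times borel_measurable_integrable[OF h] borel_measurable_modulation)
    show "(\<lambda>x. h x * exp (- (\<i> * complex_of_real (x * \<xi>)))) \<in> borel_measurable lebesgue" by (rule M)
    show "(\<lambda>x. h x * exp (- (\<i> * complex_of_real (x * u n)))) \<in> borel_measurable lebesgue" for n by (rule M)
    show "AE x in lebesgue. (\<lambda>n. h x * exp (- (\<i> * complex_of_real (x * u n))))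
        \<longlonglongrightarrow> h x * exp (- (\<i> * complex_of_real (x * \<xi>)))"
      by (intro AE_I2 tendsto_intros u)
  qed (use h in \<open>auto simp: norm_mult norm_exp_eq_Re\<close>)
  then show "((\<lambda>\<xi>. fourier_integral h \<xi>) \<circ> u) \<longlonglongrightarrow> fourier_integral h \<xi>"
    unfolding fourier_integral_def comp_def by (intro tendsto_intros)
qed

lemma fourier_integral_isometry:
  assumes R: "R > 0" and h: "h \<in> L2" and supp: "\<And>x. x \<notin> {-R..R} \<Longrightarrow> h x = 0"
  shows "fourier_integral h \<in> L2" "L2_norm (fourier_integral h) = L2_norm h"
proof -
  have "fourier_integral h \<in> borel_measurable borel"
    by (intro borel_measurable_continuous_onI fourier_integral_continuous integrable_bounded_support[OF h supp])
  then have meas: "fourier_integral h \<in> borel_measurable lebesgue"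
    by (intro measurable_completion) simp
  \<comment> \<open>Raising the frequency by p k multiplies the kernel on [-R, R] by the conjugate
    of \<open>fourier_mode R k\<close>, so the values on \<xi> + p Z are the mode coefficients of
    the modulated function \<open>g\<close>. Parseval's 2 R times 1 / (2 pi) gives R / pi, which the
    period length pi / R cancels.\<close>
  define p where "p = pi / R"
  have p: "p > 0" using R by (simp add: p_def)
  have per: "(\<Sum>n. ennreal ((cmod (fourier_integral h (\<xi> + p * of_int (int_decode n))))\<^sup>2))
      = ennreal (R / pi * (L2_norm h)\<^sup>2)" for \<xi>
  proof -
    define g where "g x = exp (- (\<i> * complex_of_real (x * \<xi>))) * h x" for x
    have nm: "cmod (exp (- (\<i> * complex_of_real (x * \<xi>)))) = 1" for x by (simp add: norm_exp_eq_Re)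
    have g: "g \<in> L2" unfolding g_def
      by (rule L2_mult_bounded[OF h borel_measurable_modulation, of _ 1]) (simp only: nm order_refl)
    have ng: "L2_norm g = L2_norm h" unfolding L2_norm_def g_def by (simp add: norm_mult nm)
    have gs: "g x = 0" if "x \<notin> {-R..R}" for x using supp[OF that] by (simp add: g_def)
    have pt: "h x * exp (- (\<i> * complex_of_real (x * (\<xi> + p * of_int k)))) = g x * cnj (fourier_mode R k x)" for k x
    proof (cases "x \<in> {-R..R}")
      case True
      have "exp (- (\<i> * complex_of_real (x * (\<xi> + p * of_int k))))
          = exp (- (\<i> * complex_of_real (x * \<xi>))) * exp (- (\<i> * complex_of_real (pi * of_int k / R * x)))"
        unfolding exp_add[symmetric] by (simp add: p_def field_simps)
      then show ?thesis using True by (simp add: g_def fourier_mode_def exp_cnj)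
    next
      case False
      then show ?thesis using supp[OF False] gs[OF False] by simp
    qed
    have "(cmod (fourier_integral h (\<xi> + p * of_int k)))\<^sup>2 = 1 / (2 * pi) * (cmod (L2_inner g (fourier_mode R k)))\<^sup>2" for k
      unfolding fourier_integral_def pt L2_inner_def[symmetric]
      by (simp add: norm_mult norm_divide power_mult_distrib power_divide real_sqrt_mult)
    then have "(\<Sum>n. ennreal ((cmod (fourier_integral h (\<xi> + p * of_int (int_decode n))))\<^sup>2))
        = (\<Sum>n. ennreal (1 / (2 * pi)) * ennreal ((cmod (L2_inner g (fourier_mode R (int_decode n))))\<^sup>2))"
      by (simp add: ennreal_mult' del: times_divide_eq_left)
    also have "\<dots> = ennreal (1 / (2 * pi)) * ennreal (2 * R * (L2_norm g)\<^sup>2)"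
      unfolding ennreal_suminf_cmult
      by (rule arg_cong, rule fourier_series_Parseval[OF R g gs])
    also have "\<dots> = ennreal (R / pi * (L2_norm h)\<^sup>2)"
      unfolding ng by (subst ennreal_mult'[symmetric]) auto
    finally show ?thesis .
  qed
  have "(\<integral>\<^sup>+\<xi>. ennreal ((cmod (fourier_integral h \<xi>))\<^sup>2) \<partial>lebesgue)
      = (\<integral>\<^sup>+\<xi>. indicator {0..<p} \<xi> * ennreal (R / pi * (L2_norm h)\<^sup>2) \<partial>lebesgue)"
    using meas by (subst nn_integral_periodize[OF _ p]) (auto simp: per)
  also have "\<dots> = ennreal (R / pi * (L2_norm h)\<^sup>2) * emeasure lebesgue {0..<p}"
    by (subst mult.commute) (rule nn_integral_cmult_indicator, simp)
  also have "\<dots> = ennreal ((L2_norm h)\<^sup>2)"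
    using p R by (simp add: p_def flip: ennreal_mult')
  finally have nn: "(\<integral>\<^sup>+\<xi>. ennreal ((cmod (fourier_integral h \<xi>))\<^sup>2) \<partial>lebesgue) = ennreal ((L2_norm h)\<^sup>2)" .
  then show L2: "fourier_integral h \<in> L2" using meas by (simp add: L2_iff_nn_integral)
  show "L2_norm (fourier_integral h) = L2_norm h"
    using nn L2_nn_norm[OF L2] L2_norm_nonneg by simp
qed

section \<open>Completeness and the Fourier isometry\<close>

text \<open>Riesz-Fischer with weights: along a fast subsequence the differences d_k have norm below
  2^{-k}, so the sum of 2^k |d_k|^2 is integrable. Its finiteness at almost every x forces geometric
  decay of d_k(x), hence pointwise convergence; Fatou upgrades this to convergence in norm.\<close>

theorem L2_complete:
  fixes s :: "nat \<Rightarrow> real \<Rightarrow> complex"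
  assumes s: "\<And>n. s n \<in> L2"
    and Cauchy: "\<And>e. e > 0 \<Longrightarrow> \<exists>N. \<forall>m\<ge>N. \<forall>n\<ge>N. L2_norm (\<lambda>x. s m x - s n x) < e"
  obtains g where "g \<in> L2" "(\<lambda>n. L2_norm (\<lambda>x. s n x - g x)) \<longlonglongrightarrow> 0"
proof -
  note [measurable] = s[THEN L2_measurable]
  obtain M where M: "\<And>k m n. m \<ge> M k \<Longrightarrow> n \<ge> M k \<Longrightarrow> L2_norm (\<lambda>x. s m x - s n x) < (1/2) ^ k"
  proof -
    have "\<forall>k::nat. \<exists>N. \<forall>m\<ge>N. \<forall>n\<ge>N. L2_norm (\<lambda>x. s m x - s n x) < (1/2) ^ k"
      using Cauchy by simp
    from choice[OF this] obtain M where "\<forall>k. \<forall>m\<ge>M k. \<forall>n\<ge>M k. L2_norm (\<lambda>x. s m x - s n x) < (1/2) ^ k" ..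
    then show thesis by (intro that) blast
  qed
  \<comment> \<open>The sum makes r k and r (Suc k) at least M k, and the added k makes r k at least
    k, so the indices tend to infinity.\<close>
  define r where "r k = (\<Sum>i\<le>k. M i) + k" for k
  have rM: "r k \<ge> M k" "r (Suc k) \<ge> M k" "r k \<ge> k" for k
    using member_le_sum[of k "{..k}" M] by (auto simp: r_def)
  define d where "d k x = s (r (Suc k)) x - s (r k) x" for k x
  have dL2: "d k \<in> L2" for k unfolding d_def by (intro L2_diff s)
  note [measurable] = dL2[THEN L2_measurable]
  have bnd: "(\<integral>\<^sup>+x. ennreal (2 ^ k * (cmod (d k x))\<^sup>2) \<partial>lebesgue) \<le> ennreal ((1/2) ^ k)" for k
  proof -
    have "(\<integral>\<^sup>+x. ennreal (2 ^ k * (cmod (d k x))\<^sup>2) \<partial>lebesgue) = ennreal (2 ^ k) * ennreal ((L2_norm (d k))\<^sup>2)"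
      by (simp add: ennreal_mult' nn_integral_cmult L2_nn_norm[OF dL2])
    also have "\<dots> = ennreal (2 ^ k * (L2_norm (d k))\<^sup>2)" by (simp add: ennreal_mult')
    also have "\<dots> \<le> ennreal (2 ^ k * ((1/2) ^ k)\<^sup>2)"
      using M[OF rM(2,1), of k] L2_norm_nonneg
      by (intro ennreal_leI mult_left_mono power_mono) (auto simp: d_def[abs_def])
    also have "2 ^ k * ((1/2) ^ k)\<^sup>2 = ((1/2) ^ k :: real)"
      by (simp add: power2_eq_square power_one_over)
    finally show ?thesis .
  qed
  have "(\<integral>\<^sup>+x. (\<Sum>k. ennreal (2 ^ k * (cmod (d k x))\<^sup>2)) \<partial>lebesgue)
      = (\<Sum>k. \<integral>\<^sup>+x. ennreal (2 ^ k * (cmod (d k x))\<^sup>2) \<partial>lebesgue)"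
    by (intro nn_integral_suminf) measurable
  also have "\<dots> \<le> (\<Sum>k. ennreal ((1/2) ^ k))" by (intro suminf_le bnd summableI)
  also have "\<dots> < \<infinity>"
  proof -
    have "summable (\<lambda>k. (1/2::real) ^ k)" by (rule summable_geometric) simp
    then have "(\<Sum>k. ennreal ((1/2) ^ k)) = ennreal (\<Sum>k. (1/2) ^ k)" by (intro suminf_ennreal2) simp_all
    then show ?thesis by simp
  qed
  finally have "AE x in lebesgue. (\<Sum>k. ennreal (2 ^ k * (cmod (d k x))\<^sup>2)) \<noteq> \<infinity>"
    by (intro nn_integral_PInf_AE) auto
  then have conv: "AE x in lebesgue. convergent (\<lambda>k. s (r k) x)"
  proof eventually_elim
    case (elim x)
    define C where "C = enn2real (\<Sum>k. ennreal (2 ^ k * (cmod (d k x))\<^sup>2))"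
    have C: "C \<ge> 0" "(\<Sum>k. ennreal (2 ^ k * (cmod (d k x))\<^sup>2)) = ennreal C"
      using elim by (simp_all add: C_def less_top)
    \<comment> \<open>From 2^k |d_k(x)|^2 \<le> C follows |d_k(x)| \<le> sqrt C * 2^{-k/2}, and q^k
      is that power.\<close>
    define q where "q = 1 / sqrt (2::real)"
    have q: "0 < q" "q < 1" "q\<^sup>2 = 1 / 2" by (simp_all add: q_def power_divide real_less_rsqrt)
    have le: "cmod (d k x) \<le> sqrt C * q ^ k" for k
    proof (rule power2_le_imp_le)
      have "sum (\<lambda>k. ennreal (2 ^ k * (cmod (d k x))\<^sup>2)) {k} \<le> ennreal C"
        unfolding C(2)[symmetric] by (rule sum_le_suminf[OF summableI]) simp_all
      then have "2 ^ k * (cmod (d k x))\<^sup>2 \<le> C" using C(1) by simp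
      then have "(cmod (d k x))\<^sup>2 \<le> C / 2 ^ k" by (subst pos_le_divide_eq) (simp_all add: mult.commute)
      also have "C / 2 ^ k = (sqrt C)\<^sup>2 * (q\<^sup>2) ^ k" using C(1) by (simp add: q(3) power_one_over)
      also have "\<dots> = (sqrt C * q ^ k)\<^sup>2"
        unfolding power_mult_distrib power_mult[symmetric] mult.commute[of k] ..
      finally show "(cmod (d k x))\<^sup>2 \<le> (sqrt C * q ^ k)\<^sup>2" .
    qed (use C q in simp)
    have "summable (\<lambda>k. sqrt C * q ^ k)"
      by (intro summable_mult summable_geometric) (use q in simp)
    then have "summable (\<lambda>k. d k x)"
      by (rule summable_comparison_test[rotated]) (intro exI[of _ 0] allI impI le)
    then have "convergent (\<lambda>n. s (r 0) x + (\<Sum>k<n. d k x))"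
      unfolding summable_iff_convergent by (intro convergent_add convergent_const)
    moreover have "s (r 0) x + (\<Sum>k<n. d k x) = s (r n) x" for n
      unfolding d_def using sum_lessThan_telescope[of "\<lambda>k. s (r k) x" n] by simp
    ultimately show ?case by simp
  qed
  define g where "g x = lim (\<lambda>k. s (r k) x)" for x
  have [measurable]: "g \<in> borel_measurable lebesgue"
    unfolding g_def by measurable
  have lim: "AE x in lebesgue. (\<lambda>k. s (r k) x) \<longlonglongrightarrow> g x"
    using conv unfolding g_def by eventually_elim (simp add: convergent_LIMSEQ_iff)
  \<comment> \<open>Fatou along r: \<open>s n - g\<close> is the pointwise limit of
    \<open>s n - s (r k)\<close>, whose norms are eventually below 2^{-j}.\<close>
  have est: "(\<lambda>x. s n x - g x) \<in> L2 \<and> L2_norm (\<lambda>x. s n x - g x) \<le> (1/2) ^ j" if n: "n \<ge> M j" for n j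
  proof -
    have "(\<integral>\<^sup>+x. ennreal ((cmod (s n x - g x))\<^sup>2) \<partial>lebesgue)
        = (\<integral>\<^sup>+x. liminf (\<lambda>k. ennreal ((cmod (s n x - s (r k) x))\<^sup>2)) \<partial>lebesgue)"
    proof (intro nn_integral_cong_AE)
      show "AE x in lebesgue. ennreal ((cmod (s n x - g x))\<^sup>2)
          = liminf (\<lambda>k. ennreal ((cmod (s n x - s (r k) x))\<^sup>2))"
        using lim
      proof eventually_elim
        case (elim x)
        have "(\<lambda>k. ennreal ((cmod (s n x - s (r k) x))\<^sup>2)) \<longlonglongrightarrow> ennreal ((cmod (s n x - g x))\<^sup>2)"
          by (intro tendsto_ennrealI tendsto_intros elim)
        then show ?case by (rule lim_imp_Liminf[OF sequentially_bot, symmetric])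
      qed
    qed
    also have "\<dots> \<le> liminf (\<lambda>k. \<integral>\<^sup>+x. ennreal ((cmod (s n x - s (r k) x))\<^sup>2) \<partial>lebesgue)"
      by (intro nn_integral_liminf) measurable
    also have "\<dots> \<le> ennreal (((1/2) ^ j)\<^sup>2)"
    proof (rule Liminf_le)
      have "(\<integral>\<^sup>+x. ennreal ((cmod (s n x - s (r k) x))\<^sup>2) \<partial>lebesgue) \<le> ennreal (((1/2) ^ j)\<^sup>2)" if "k \<ge> M j" for k
      proof -
        have "L2_norm (\<lambda>x. s n x - s (r k) x) < (1/2) ^ j"
          using n that rM(3)[of k] by (intro M) auto
        then show ?thesis
          using L2_norm_nonneg by (subst L2_nn_norm[OF L2_diff[OF s s]]) (auto intro!: ennreal_leI power_mono)
      qed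
      then show "\<forall>\<^sub>F k in sequentially. (\<integral>\<^sup>+x. ennreal ((cmod (s n x - s (r k) x))\<^sup>2) \<partial>lebesgue) \<le> ennreal (((1/2) ^ j)\<^sup>2)"
        by (auto simp: eventually_sequentially)
    qed simp
    finally have le: "(\<integral>\<^sup>+x. ennreal ((cmod (s n x - g x))\<^sup>2) \<partial>lebesgue) \<le> ennreal (((1/2) ^ j)\<^sup>2)" .
    also have "\<dots> < \<infinity>" by simp
    finally have L: "(\<lambda>x. s n x - g x) \<in> L2" by (auto simp: L2_iff_nn_integral)
    have "(L2_norm (\<lambda>x. s n x - g x))\<^sup>2 \<le> ((1/2) ^ j)\<^sup>2"
      using le unfolding L2_nn_norm[OF L] by (subst (asm) ennreal_le_iff) auto
    then show ?thesis using L by (auto dest: power2_le_imp_le)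
  qed
  show thesis
  proof
    show "g \<in> L2" using L2_diff[OF s[of "M 0"] est[of 0 "M 0", THEN conjunct1]] by simp
    show "(\<lambda>n. L2_norm (\<lambda>x. s n x - g x)) \<longlonglongrightarrow> 0"
    proof (rule LIMSEQ_I)
      fix e :: real assume "e > 0"
      then obtain j where j: "(1/2) ^ j < e" using real_arch_pow_inv[of e "1/2"] by auto
      have "norm (L2_norm (\<lambda>x. s n x - g x) - 0) < e" if "n \<ge> M j" for n
        using est[OF that] j L2_norm_nonneg[of "\<lambda>x. s n x - g x"] by auto
      then show "\<exists>N. \<forall>n\<ge>N. norm (L2_norm (\<lambda>x. s n x - g x) - 0) < e" by blast
    qed
  qed
qed

section \<open>The Fourier transform on L2 as a limit of truncated integrals\<close>

definition truncation :: "(real \<Rightarrow> complex) \<Rightarrow> real \<Rightarrow> real \<Rightarrow> complex" where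
  "truncation f R x = indicator {-R..R} x * f x"

lemma L2_truncation: assumes "f \<in> L2" shows "truncation f R \<in> L2"
proof -
  have "(\<lambda>x. indicator {-R..R} x :: complex) \<in> borel_measurable lebesgue"
    by (intro borel_measurable_indicator) auto
  then show ?thesis
    unfolding truncation_def[abs_def]
    by (intro L2_mult_bounded[OF assms, of _ 1]) (auto simp: indicator_def)
qed

lemma truncated_fourier_eq: "truncated_fourier f R = fourier_integral (truncation f R)"
  unfolding truncated_fourier_def fourier_integral_def set_lebesgue_integral_def truncation_def
  by (intro ext arg_cong2[where f = "(*)"] refl Bochner_Integration.integral_cong)
    (auto simp: indicator_def)

lemma L2_tendsto_truncation:
  assumes f: "f \<in> L2" shows "L2_tendsto (truncation f) f at_top"
proof -
  note T = L2_truncation[OF f]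
  have "((\<lambda>R. LINT x|lebesgue. (cmod (truncation f R x - f x))\<^sup>2) \<longlongrightarrow> (LINT x|(lebesgue :: real measure). (0::real))) at_top"
  proof (rule integral_dominated_convergence_at_top[where w = "\<lambda>x. (cmod (f x))\<^sup>2"])
    show "(\<lambda>x. (cmod (truncation f R x - f x))\<^sup>2) \<in> borel_measurable lebesgue" for R
      by (rule borel_measurable_integrable[OF L2_integrable[OF L2_diff[OF T f]]])
    show "integrable lebesgue (\<lambda>x. (cmod (f x))\<^sup>2)" by (rule L2_integrable[OF f])
    show "\<forall>\<^sub>F R in at_top. AE x in lebesgue. norm ((cmod (truncation f R x - f x))\<^sup>2) \<le> (cmod (f x))\<^sup>2"
      by (intro always_eventually allI AE_I2) (auto simp: truncation_def indicator_def)
    show "AE x in lebesgue. ((\<lambda>R. (cmod (truncation f R x - f x))\<^sup>2) \<longlongrightarrow> 0) at_top"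
    proof (intro AE_I2 tendsto_eventually)
      fix x
      show "\<forall>\<^sub>F R in at_top. (cmod (truncation f R x - f x))\<^sup>2 = 0"
        using eventually_ge_at_top[of "\<bar>x\<bar>"]
        by eventually_elim (auto simp: truncation_def indicator_def)
    qed
  qed simp
  then have "((\<lambda>R. sqrt (LINT x|lebesgue. (cmod (truncation f R x - f x))\<^sup>2)) \<longlongrightarrow> sqrt 0) at_top"
    by (intro tendsto_real_sqrt) simp
  then show ?thesis using f T by (simp add: L2_tendsto_def L2_norm_def)
qed

text \<open>The difference of two truncations has bounded support, so the isometry reduces the
  Cauchy property of the transforms to that of the truncations.\<close>

lemma truncated_fourier_diff_norm:
  assumes f: "f \<in> L2"
  shows "L2_norm (\<lambda>\<xi>. truncated_fourier f R \<xi> - truncated_fourier f S \<xi>)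
    = L2_norm (\<lambda>x. truncation f R x - truncation f S x)"
proof -
  let ?h = "\<lambda>x. truncation f R x - truncation f S x"
  \<comment> \<open>A positive radius, as the isometry requires, that covers both intervals even
    when \<open>R\<close> or \<open>S\<close> is negative.\<close>
  define B where "B = max 1 (max R S)"
  have supp: "truncation f R x = 0" "truncation f S x = 0" "?h x = 0" if "x \<notin> {-B..B}" for x
    using that by (auto simp: truncation_def B_def indicator_def)
  have int: "integrable lebesgue (\<lambda>x. truncation f Q x * exp (- (\<i> * complex_of_real (x * \<xi>))))"
    if "integrable lebesgue (truncation f Q)" for Q \<xi>
  proof (rule Bochner_Integration.integrable_bound[OF that])
    show "(\<lambda>x. truncation f Q x * exp (- (\<i> * complex_of_real (x * \<xi>)))) \<in> borel_measurable lebesgue"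
      by (intro borel_measurable_times borel_measurable_integrable[OF that] borel_measurable_modulation)
  qed (simp add: norm_mult norm_exp_eq_Re)
  have "(\<lambda>\<xi>. truncated_fourier f R \<xi> - truncated_fourier f S \<xi>) = fourier_integral ?h"
    unfolding truncated_fourier_eq fourier_integral_def left_diff_distrib
    by (subst Bochner_Integration.integral_diff)
      (auto intro!: int integrable_bounded_support[OF L2_truncation[OF f], of B] simp: supp right_diff_distrib
        simp del: of_real_mult)
  moreover have "L2_norm (fourier_integral ?h) = L2_norm ?h"
    by (rule fourier_integral_isometry(2)[of B]) (auto simp: supp B_def intro!: L2_diff L2_truncation f)
  ultimately show ?thesis by simp
qed

lemma truncated_fourier_L2: assumes f: "f \<in> L2" shows "truncated_fourier f R \<in> L2"
  unfolding truncated_fourier_eq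
  by (rule fourier_integral_isometry(1)[of "max 1 R"])
    (auto simp: truncation_def indicator_def intro: L2_truncation[OF f])

text \<open>The choice in \<open>fourier\<close> is justified by exhibiting a limit.\<close>

theorem fourier_tendsto:
  assumes f: "f \<in> L2" shows "L2_tendsto (truncated_fourier f) (fourier f) at_top"
proof -
  note T = L2_truncation[OF f] and F = truncated_fourier_L2[OF f]
  have trunc: "\<exists>B. \<forall>R\<ge>B. L2_norm (\<lambda>x. truncation f R x - f x) < e" if "e > 0" for e
  proof -
    have "((\<lambda>R. L2_norm (\<lambda>x. truncation f R x - f x)) \<longlongrightarrow> 0) at_top"
      using L2_tendsto_truncation[OF f] by (simp add: L2_tendsto_def)
    from order_tendstoD(2)[OF this that] show ?thesis by (simp add: eventually_at_top_linorder)
  qed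
  have cauchy: "\<exists>B. \<forall>R\<ge>B. \<forall>S\<ge>B. L2_norm (\<lambda>\<xi>. truncated_fourier f R \<xi> - truncated_fourier f S \<xi>) < e"
    if "e > 0" for e
  proof -
    have "e / 2 > 0" using that by simp
    then obtain B where B: "\<And>R. R \<ge> B \<Longrightarrow> L2_norm (\<lambda>x. truncation f R x - f x) < e / 2"
      using trunc by blast
    have "L2_norm (\<lambda>\<xi>. truncated_fourier f R \<xi> - truncated_fourier f S \<xi>) < e" if "R \<ge> B" "S \<ge> B" for R S
      using L2_norm_diff_triangle[OF T[of R] f T[of S]] B[OF that(1)] B[OF that(2)]
        L2_norm_minus_commute[of f "truncation f S"]
      by (simp add: truncated_fourier_diff_norm[OF f])
    then show ?thesis by blast
  qed
  \<comment> \<open>Completeness is about sequences, so the limit is taken along integer radii; the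
    Cauchy estimate then carries it over to real radii.\<close>
  have "\<exists>N. \<forall>m\<ge>N. \<forall>n\<ge>N. L2_norm (\<lambda>\<xi>. truncated_fourier f (real m) \<xi> - truncated_fourier f (real n) \<xi>) < e"
    if e: "e > 0" for e
  proof -
    obtain B where B: "\<forall>R\<ge>B. \<forall>S\<ge>B. L2_norm (\<lambda>\<xi>. truncated_fourier f R \<xi> - truncated_fourier f S \<xi>) < e"
      using cauchy[OF e] by blast
    obtain N :: nat where N: "B \<le> real N" using real_arch_simple by blast
    have "\<forall>m\<ge>N. \<forall>n\<ge>N. L2_norm (\<lambda>\<xi>. truncated_fourier f (real m) \<xi> - truncated_fourier f (real n) \<xi>) < e"
      using N B by (metis of_nat_le_iff order_trans)
    then show ?thesis by blast
  qed
  from L2_complete[of "\<lambda>n. truncated_fourier f (real n)", OF F this]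
  obtain g where g: "g \<in> L2" "(\<lambda>n. L2_norm (\<lambda>\<xi>. truncated_fourier f (real n) \<xi> - g \<xi>)) \<longlonglongrightarrow> 0" by blast
  have "((\<lambda>R. L2_norm (\<lambda>\<xi>. truncated_fourier f R \<xi> - g \<xi>)) \<longlongrightarrow> 0) at_top"
  proof (rule tendstoI)
    fix e :: real assume "e > 0"
    then have e: "e / 2 > 0" by simp
    obtain B where B: "\<forall>R\<ge>B. \<forall>S\<ge>B. L2_norm (\<lambda>\<xi>. truncated_fourier f R \<xi> - truncated_fourier f S \<xi>) < e / 2"
      using cauchy[OF e] by blast
    have "\<forall>\<^sub>F n in sequentially. L2_norm (\<lambda>\<xi>. truncated_fourier f (real n) \<xi> - g \<xi>) < e / 2 \<and> B \<le> real n"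
      using order_tendstoD(2)[OF g(2) e] eventually_ge_at_top[of "nat \<lceil>B\<rceil>"]
      by eventually_elim linarith
    then obtain n :: nat where n: "L2_norm (\<lambda>\<xi>. truncated_fourier f (real n) \<xi> - g \<xi>) < e / 2" "B \<le> real n"
      by (auto dest: eventually_happens)
    show "\<forall>\<^sub>F R in at_top. dist (L2_norm (\<lambda>\<xi>. truncated_fourier f R \<xi> - g \<xi>)) 0 < e"
      using eventually_ge_at_top[of B]
    proof eventually_elim
      case (elim R)
      have "L2_norm (\<lambda>\<xi>. truncated_fourier f R \<xi> - truncated_fourier f (real n) \<xi>) < e / 2"
        using B elim n(2) by blast
      then show ?case
        using L2_norm_diff_triangle[OF F[of R] F[of "real n"] g(1)] n(1)
          L2_norm_nonneg[of "\<lambda>\<xi>. truncated_fourier f R \<xi> - g \<xi>"] by (simp add: dist_real_def)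
    qed
  qed
  then have "L2_tendsto (truncated_fourier f) g at_top" using F g(1) by (simp add: L2_tendsto_def)
  then show ?thesis
    unfolding fourier_def by (rule someI[of "\<lambda>g. L2_tendsto (truncated_fourier f) g at_top"])
qed

lemma fourier_L2: "f \<in> L2 \<Longrightarrow> fourier f \<in> L2"
  using fourier_tendsto by (simp add: L2_tendsto_def)

text \<open>The Fourier multiplier of a finite combination of translations. The index type is
  arbitrary, so two indices may carry the same frequency.\<close>

definition exp_sum :: "'i set \<Rightarrow> ('i \<Rightarrow> complex) \<Rightarrow> ('i \<Rightarrow> real) \<Rightarrow> real \<Rightarrow> complex" where
  "exp_sum J b \<alpha> \<xi> = (\<Sum>j\<in>J. b j * exp (- (\<i> * complex_of_real (\<alpha> j * \<xi>))))"

lemma exp_sum_bound: "cmod (exp_sum J b \<alpha> \<xi>) \<le> (\<Sum>j\<in>J. cmod (b j))"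
  unfolding exp_sum_def by (rule order_trans[OF norm_sum]) (simp add: norm_mult norm_exp_eq_Re)

lemma borel_measurable_exp_sum: "exp_sum J b \<alpha> \<in> borel_measurable borel"
  unfolding exp_sum_def[abs_def] by measurable

lemma fourier_integral_exp_sum:
  assumes h: "integrable lebesgue h"
  shows "fourier_integral (\<lambda>x. \<Sum>j\<in>J. b j * translation (\<alpha> j) h x) \<xi> = exp_sum J b \<alpha> \<xi> * fourier_integral h \<xi>"
proof -
  have E: "integrable lebesgue (\<lambda>x. h x * exp (- (\<i> * complex_of_real (x * \<xi>))))"
  proof (rule Bochner_Integration.integrable_bound[OF h])
    show "(\<lambda>x. h x * exp (- (\<i> * complex_of_real (x * \<xi>)))) \<in> borel_measurable lebesgue"
      by (intro borel_measurable_times borel_measurable_integrable[OF h] borel_measurable_modulation)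
  qed (simp add: norm_mult norm_exp_eq_Re)
  have shift: "translation a h x * exp (- (\<i> * complex_of_real (x * \<xi>)))
      = exp (- (\<i> * complex_of_real (a * \<xi>))) * (h (- a + 1 * x) * exp (- (\<i> * complex_of_real ((- a + 1 * x) * \<xi>))))" for a x
  proof -
    have "exp (- (\<i> * complex_of_real (x * \<xi>)))
        = exp (- (\<i> * complex_of_real (a * \<xi>))) * exp (- (\<i> * complex_of_real ((- a + 1 * x) * \<xi>)))"
      unfolding exp_add[symmetric] by (simp add: algebra_simps)
    then show ?thesis by (simp add: translation_def)
  qed
  have int: "integrable lebesgue (\<lambda>x. translation a h x * exp (- (\<i> * complex_of_real (x * \<xi>))))" for a
    unfolding shift by (intro integrable_mult_right lebesgue_integrable_real_affine[OF E]) simp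
  have tr: "(LINT x|lebesgue. translation a h x * exp (- (\<i> * complex_of_real (x * \<xi>))))
      = exp (- (\<i> * complex_of_real (a * \<xi>))) * (LINT x|lebesgue. h x * exp (- (\<i> * complex_of_real (x * \<xi>))))" for a
    using lebesgue_integral_real_affine[of 1 "\<lambda>x. h x * exp (- (\<i> * complex_of_real (x * \<xi>)))" "- a"]
    unfolding shift by simp
  have "(LINT x|lebesgue. (\<Sum>j\<in>J. b j * translation (\<alpha> j) h x) * exp (- (\<i> * complex_of_real (x * \<xi>))))
      = (\<Sum>j\<in>J. LINT x|lebesgue. b j * (translation (\<alpha> j) h x * exp (- (\<i> * complex_of_real (x * \<xi>)))))"
    unfolding sum_distrib_right mult.assoc by (intro Bochner_Integration.integral_sum integrable_mult_right int)
  also have "\<dots> = exp_sum J b \<alpha> \<xi> * (LINT x|lebesgue. h x * exp (- (\<i> * complex_of_real (x * \<xi>))))"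
    unfolding exp_sum_def sum_distrib_right by (simp only: integral_mult_right_zero tr mult.assoc)
  finally show ?thesis unfolding fourier_integral_def by (simp only: mult.left_commute)
qed

text \<open>For the truncations of \<open>f\<close> the combination of translates has bounded
  support and \<open>fourier_integral_isometry\<close> applies; both sides then pass to the limit in
  norm as the radius grows.\<close>

theorem fourier_isometry:
  assumes f: "f \<in> L2" and J: "finite J"
  shows "L2_norm (\<lambda>x. \<Sum>j\<in>J. b j * translation (\<alpha> j) f x) = L2_norm (\<lambda>\<xi>. exp_sum J b \<alpha> \<xi> * fourier f \<xi>)"
proof -
  note T = L2_truncation[OF f]
  have "L2_tendsto (\<lambda>R x. b j * translation (\<alpha> j) (truncation f R) x) (\<lambda>x. b j * translation (\<alpha> j) f x) at_top" for j
  proof (rule L2_tendsto_mult_bounded)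
    have "L2_norm (\<lambda>x. translation (\<alpha> j) (truncation f R) x - translation (\<alpha> j) f x)
        = L2_norm (\<lambda>x. truncation f R x - f x)" for R
      unfolding L2_norm_def
      using lebesgue_integral_real_affine[of 1 "\<lambda>x. (cmod (truncation f R x - f x))\<^sup>2" "- \<alpha> j"]
      by (simp add: translation_def)
    then show "L2_tendsto (\<lambda>R. translation (\<alpha> j) (truncation f R)) (translation (\<alpha> j) f) at_top"
      using L2_tendsto_truncation[OF f] by (simp add: L2_tendsto_def L2_translation)
  qed auto
  then have left: "((\<lambda>R. L2_norm (\<lambda>x. \<Sum>j\<in>J. b j * translation (\<alpha> j) (truncation f R) x))
      \<longlongrightarrow> L2_norm (\<lambda>x. \<Sum>j\<in>J. b j * translation (\<alpha> j) f x)) at_top"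
    by (intro L2_tendsto_norm L2_tendsto_sum)
  have m: "exp_sum J b \<alpha> \<in> borel_measurable lebesgue"
    by (intro measurable_completion) (simp add: borel_measurable_exp_sum)
  have right: "((\<lambda>R. L2_norm (\<lambda>\<xi>. exp_sum J b \<alpha> \<xi> * truncated_fourier f R \<xi>))
      \<longlongrightarrow> L2_norm (\<lambda>\<xi>. exp_sum J b \<alpha> \<xi> * fourier f \<xi>)) at_top"
    by (intro L2_tendsto_norm L2_tendsto_mult_bounded[OF fourier_tendsto[OF f] m exp_sum_bound])
  have eq: "L2_norm (\<lambda>x. \<Sum>j\<in>J. b j * translation (\<alpha> j) (truncation f R) x)
      = L2_norm (\<lambda>\<xi>. exp_sum J b \<alpha> \<xi> * truncated_fourier f R \<xi>)" for R
  proof -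
    let ?g = "\<lambda>x. \<Sum>j\<in>J. b j * translation (\<alpha> j) (truncation f R) x"
    \<comment> \<open>A translate by \<open>\<alpha> j\<close> of a function on [-R, R] stays within
      this radius, since |\<open>\<alpha> j\<close>| is at most the sum of all of them.\<close>
    define B where "B = max 1 (R + (\<Sum>j\<in>J. \<bar>\<alpha> j\<bar>))"
    have int: "integrable lebesgue (truncation f R)"
      by (rule integrable_bounded_support[where R = R, OF T]) (simp add: truncation_def)
    have "translation (\<alpha> j) (truncation f R) x = 0" if "j \<in> J" "x \<notin> {-B..B}" for j x
    proof -
      have "\<bar>\<alpha> j\<bar> \<le> (\<Sum>j\<in>J. \<bar>\<alpha> j\<bar>)" using J that(1) by (intro member_le_sum) auto
      then have "x - \<alpha> j \<notin> {-R..R}" using that(2) unfolding B_def atLeastAtMost_iff by linarith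
      then show ?thesis by (simp add: translation_def truncation_def)
    qed
    then have supp: "?g x = 0" if "x \<notin> {-B..B}" for x using that by simp
    have "L2_norm (fourier_integral ?g) = L2_norm ?g"
      by (rule fourier_integral_isometry(2)[of B]) (use supp in \<open>auto simp: B_def intro!: L2_sum L2_scale L2_translation T\<close>)
    moreover have "fourier_integral ?g = (\<lambda>\<xi>. exp_sum J b \<alpha> \<xi> * truncated_fourier f R \<xi>)"
      unfolding truncated_fourier_eq using fourier_integral_exp_sum[OF int] by blast
    ultimately show ?thesis by simp
  qed
  show ?thesis
    using tendsto_unique[OF _ left[unfolded eq] right] by simp
qed

section \<open>Shift invariance and partial self-similarity\<close>

lemma AE_lebesgue_translate:
  fixes c :: real
  assumes "AE x in lebesgue. P x" shows "AE x in lebesgue. P (x + c)"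
proof -
  obtain N where N: "N \<in> null_sets lebesgue" "{x. \<not> P x} \<subseteq> N"
    using assms by (auto simp: eventually_ae_filter)
  then have "negligible ((+) (- c) ` N)"
    by (intro negligible_translation) (simp add: negligible_iff_null_sets)
  moreover have "{x. \<not> P (x + c)} \<subseteq> (+) (- c) ` N"
  proof
    fix x assume "x \<in> {x. \<not> P (x + c)}"
    then have "x + c \<in> N" using N(2) by blast
    then show "x \<in> (+) (- c) ` N" by (intro image_eqI[of _ _ "x + c"]) auto
  qed
  ultimately show ?thesis
    by (auto simp: eventually_ae_filter negligible_iff_null_sets)
qed

lemma exp_minus_periodic: "exp (- (\<i> * complex_of_real (of_int l * (\<xi> + 2 * pi * of_int k))))
    = exp (- (\<i> * complex_of_real (of_int l * \<xi>)))"
  unfolding exp_eq by (intro exI[of _ "- (l * k)"]) (simp add: algebra_simps)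

lemma exp_sum_periodic: "exp_sum L c of_int (\<xi> + 2 * pi * of_int k) = exp_sum L c of_int \<xi>"
  unfolding exp_sum_def exp_minus_periodic ..

lemma L2_norm_shift_approx:
  assumes \<psi>: "\<psi> \<in> L2" and L: "finite L"
  shows "L2_norm (\<lambda>x. translation \<beta> \<psi> x - (\<Sum>l\<in>L. c l * translation (of_int l) \<psi> x))
    = L2_norm (\<lambda>\<xi>. (exp (- (\<i> * complex_of_real (\<beta> * \<xi>))) - exp_sum L c of_int \<xi>) * fourier \<psi> \<xi>)"
proof -
  \<comment> \<open>\<open>None\<close> carries the frequency \<beta> and \<open>Some l\<close> the
    integer l, so the terms stay separate even if \<beta> is an integer.\<close>
  define J where "J = insert None (Some ` L)"
  define b where "b j = (case j of None \<Rightarrow> 1 | Some l \<Rightarrow> - c l)" for j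
  define \<alpha> where "\<alpha> j = (case j of None \<Rightarrow> \<beta> | Some l \<Rightarrow> real_of_int l)" for j
  have sum: "(\<Sum>j\<in>J. f j) = f None + (\<Sum>l\<in>L. f (Some l))" for f :: "int option \<Rightarrow> complex"
    unfolding J_def using L by (simp add: sum.reindex)
  have "finite J" using L by (simp add: J_def)
  from fourier_isometry[OF \<psi> this, of b \<alpha>] show ?thesis
    unfolding sum exp_sum_def by (simp add: b_def \<alpha>_def sum_negf)
qed

text \<open>Approximants from integer shifts yield 2 pi-periodic polynomials p_n that, along a
  subsequence, tend to e^{-i \<beta> xi} almost everywhere on the support. At a point of F and its
  translate by 2 pi K the limits agree, forcing e^{-2 pi i \<beta> K} = 1.\<close>

lemma shift_invariant_not_self_similar:
  assumes \<psi>: "\<psi> \<in> L2" and mem: "translation \<beta> \<psi> \<in> closed_span (range (\<lambda>l. affine_system \<psi> 0 l))"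
    and K: "\<beta> * of_int K \<notin> \<int>"
  shows "\<not> partially_self_similar (fourier_support \<psi>) (2 * pi * of_int K)"
proof
  assume "partially_self_similar (fourier_support \<psi>) (2 * pi * of_int K)"
  then obtain F where F: "F \<in> sets lebesgue" "emeasure lebesgue F \<noteq> 0" "F \<subseteq> fourier_support \<psi>"
    "(\<lambda>x. x + 2 * pi * of_int K) ` F \<subseteq> fourier_support \<psi>"
    unfolding partially_self_similar_def by blast
  let ?e = "\<lambda>\<xi>. exp (- (\<i> * complex_of_real (\<beta> * \<xi>)))"
  let ?approx = "\<lambda>n L c. finite L \<and>
      L2_norm (\<lambda>x. translation \<beta> \<psi> x - (\<Sum>l\<in>L. c l * translation (of_int l) \<psi> x)) < 1 / real (Suc n)"
  have "\<exists>L c. ?approx n L c" for n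
  proof -
    have "1 / real (Suc n) > 0" by simp
    then obtain s where s: "s \<in> cfun.span (range (\<lambda>l. affine_system \<psi> 0 l))"
      "L2_norm (\<lambda>x. translation \<beta> \<psi> x - s x) < 1 / real (Suc n)"
      using closed_span_approx[OF mem] by blast
    obtain L c where "finite L" "s = (\<lambda>x. \<Sum>l\<in>L. c l * translation (of_int l) \<psi> x)"
      using span_shifts[OF s(1)] by blast
    with s(2) show ?thesis by blast
  qed
  then have "\<forall>n. \<exists>L c. ?approx n L c" ..
  from choice[OF this] obtain L where "\<forall>n. \<exists>c. ?approx n (L n) c" ..
  from choice[OF this] obtain c where "\<forall>n. ?approx n (L n) (c n)" ..
  then have L: "\<And>n. finite (L n)"
    and c: "\<And>n. L2_norm (\<lambda>x. translation \<beta> \<psi> x - (\<Sum>l\<in>L n. c n l * translation (of_int l) \<psi> x)) < 1 / real (Suc n)"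
    by blast+
  define p where "p n = exp_sum (L n) (c n) of_int" for n
  define v where "v n \<xi> = (?e \<xi> - p n \<xi>) * fourier \<psi> \<xi>" for n \<xi>
  have v_norm: "L2_norm (v n) < 1 / real (Suc n)" for n
    using c[of n] unfolding L2_norm_shift_approx[OF \<psi> L] v_def[abs_def] p_def .
  have vL2: "v n \<in> L2" for n
  proof -
    have "cmod (?e \<xi> - p n \<xi>) \<le> 1 + (\<Sum>l\<in>L n. cmod (c n l))" for \<xi>
      using norm_triangle_ineq4[of "?e \<xi>" "p n \<xi>"] exp_sum_bound[of "L n" "c n" of_int \<xi>]
      unfolding p_def by (simp add: norm_exp_eq_Re)
    moreover have "(\<lambda>\<xi>. ?e \<xi> - p n \<xi>) \<in> borel_measurable lebesgue"
    proof (intro measurable_completion)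
      note borel_measurable_exp_sum[measurable]
      have "(\<lambda>\<xi>. ?e \<xi> - p n \<xi>) \<in> borel_measurable borel" unfolding p_def by measurable
      then show "(\<lambda>\<xi>. ?e \<xi> - p n \<xi>) \<in> borel_measurable lborel" by simp
    qed
    ultimately show ?thesis unfolding v_def by (intro L2_mult_bounded[OF fourier_L2[OF \<psi>]])
  qed
  have "(\<lambda>n. LINT \<xi>|lebesgue. norm ((cmod (v n \<xi>))\<^sup>2)) \<longlonglongrightarrow> 0"
  proof (rule tendsto_sandwich[OF _ _ tendsto_const])
    have "(\<lambda>n. (inverse (real (Suc n)))\<^sup>2) \<longlonglongrightarrow> 0\<^sup>2"
      by (intro tendsto_intros LIMSEQ_inverse_real_of_nat)
    then show "(\<lambda>n. (1 / real (Suc n))\<^sup>2) \<longlonglongrightarrow> 0" by (simp add: inverse_eq_divide)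
    have "(LINT \<xi>|lebesgue. norm ((cmod (v n \<xi>))\<^sup>2)) = (L2_norm (v n))\<^sup>2" for n
      by (simp add: L2_norm_sq)
    then show "\<forall>\<^sub>F n in sequentially. (LINT \<xi>|lebesgue. norm ((cmod (v n \<xi>))\<^sup>2)) \<le> (1 / real (Suc n))\<^sup>2"
      using v_norm L2_norm_nonneg by (intro always_eventually allI) (metis less_imp_le power_mono)
  qed simp
  from tendsto_L1_AE_subseq[OF L2_integrable[OF vL2] this]
  obtain r where r: "strict_mono r" and ae: "AE \<xi> in lebesgue. (\<lambda>n. (cmod (v (r n) \<xi>))\<^sup>2) \<longlonglongrightarrow> 0"
    by blast
  have lim: "(\<lambda>n. p (r n) \<xi>) \<longlonglongrightarrow> ?e \<xi>"
    if v: "(\<lambda>n. (cmod (v (r n) \<xi>))\<^sup>2) \<longlonglongrightarrow> 0" and \<xi>: "\<xi> \<in> fourier_support \<psi>" for \<xi>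
  proof -
    have "(\<lambda>n. sqrt ((cmod (v (r n) \<xi>))\<^sup>2)) \<longlonglongrightarrow> sqrt 0" by (intro tendsto_real_sqrt v)
    then have "(\<lambda>n. v (r n) \<xi>) \<longlonglongrightarrow> 0" by (simp add: tendsto_norm_zero_iff)
    \<comment> \<open>On the support the transform is nonzero, so the weighted error may be divided
      by it.\<close>
    then have "(\<lambda>n. ?e \<xi> - v (r n) \<xi> / fourier \<psi> \<xi>) \<longlonglongrightarrow> ?e \<xi> - 0 / fourier \<psi> \<xi>"
      using \<xi> by (intro tendsto_intros) (auto simp: fourier_support_def)
    moreover have "?e \<xi> - v (r n) \<xi> / fourier \<psi> \<xi> = p (r n) \<xi>" for n
      using \<xi> by (simp add: v_def fourier_support_def)
    ultimately show ?thesis by simp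
  qed
  have "\<exists>\<xi>\<in>F. (\<lambda>n. (cmod (v (r n) \<xi>))\<^sup>2) \<longlonglongrightarrow> 0 \<and>
      (\<lambda>n. (cmod (v (r n) (\<xi> + 2 * pi * of_int K)))\<^sup>2) \<longlonglongrightarrow> 0"
  proof (rule ccontr)
    assume none: "\<not> ?thesis"
    \<comment> \<open>Convergence holds almost everywhere both at \<xi> and at its translate; if no
      point of F had both, F would be null.\<close>
    have "AE \<xi> in lebesgue. \<xi> \<notin> F"
      using ae AE_lebesgue_translate[OF ae] by eventually_elim (use none in blast)
    then have "F \<in> null_sets lebesgue" using F(1) by (simp add: AE_iff_null_sets)
    then show False using F(2) by auto
  qed
  then obtain \<xi> where \<xi>: "\<xi> \<in> F" "(\<lambda>n. (cmod (v (r n) \<xi>))\<^sup>2) \<longlonglongrightarrow> 0"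
    "(\<lambda>n. (cmod (v (r n) (\<xi> + 2 * pi * of_int K)))\<^sup>2) \<longlonglongrightarrow> 0" by blast
  have "(\<lambda>n. p (r n) \<xi>) \<longlonglongrightarrow> ?e \<xi>" using lim[OF \<xi>(2)] F(3) \<xi>(1) by blast
  moreover have "(\<lambda>n. p (r n) (\<xi> + 2 * pi * of_int K)) \<longlonglongrightarrow> ?e (\<xi> + 2 * pi * of_int K)"
    using lim[OF \<xi>(3)] F(4) \<xi>(1) by blast
  ultimately have "?e \<xi> = ?e (\<xi> + 2 * pi * of_int K)"
    unfolding p_def exp_sum_periodic by (rule LIMSEQ_unique)
  then obtain n :: int where "- (\<i> * complex_of_real (\<beta> * \<xi>))
      = - (\<i> * complex_of_real (\<beta> * (\<xi> + 2 * pi * of_int K))) + of_real (of_int (2 * n) * pi) * \<i>"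
    unfolding exp_eq by blast
  then have "\<beta> * (2 * pi * of_int K) = of_int (2 * n) * pi"
    by (simp add: complex_eq_iff algebra_simps)
  then have "\<beta> * of_int K = of_int n" by simp
  with K show False by simp
qed

lemma fourier_support_measurable: "\<psi> \<in> L2 \<Longrightarrow> fourier_support \<psi> \<in> sets lebesgue"
  using measurable_sets[OF L2_measurable[OF fourier_L2], of \<psi> "- {0}"]
  by (simp add: fourier_support_def vimage_def Compl_eq)

lemma sets_lebesgue_shift:
  fixes E :: "real set" assumes "E \<in> sets lebesgue" shows "{\<xi>. \<xi> + c \<in> E} \<in> sets lebesgue"
proof -
  have "(\<lambda>x. c + 1 * x) \<in> lebesgue \<rightarrow>\<^sub>M lebesgue"
    using lebesgue_affine_measurable[of "\<lambda>_. 1" c] by simp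
  from measurable_sets[OF this assms] show ?thesis by (simp add: vimage_def add.commute)
qed

lemma periodic_int:
  fixes M :: "real \<Rightarrow> 'a" assumes "\<And>\<xi>. M (\<xi> + p) = M \<xi>" shows "M (\<xi> + p * of_int k) = M \<xi>"
proof (induction k rule: int_induct[where k = 0])
  case (step1 i)
  then show ?case using assms[of "\<xi> + p * of_int i"] by (simp add: algebra_simps)
next
  case (step2 i)
  then show ?case using assms[of "\<xi> + p * of_int (i - 1)"] by (simp add: algebra_simps)
qed simp

text \<open>On the circle with measure \<nu>, the L2 distance from the bounded function M to a
  Laurent polynomial equals the L2 distance from the translate of \<psi> to the corresponding
  combination of integer shifts.\<close>

lemma periodic_multiplier_shift_invariant:
  assumes \<psi>: "\<psi> \<in> L2"
    and M [measurable]: "M \<in> borel_measurable borel" and per: "\<And>\<xi>. M (\<xi> + 2 * pi) = M \<xi>"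
    and bound: "\<And>\<xi>. cmod (M \<xi>) \<le> C"
    and eq: "AE \<xi> in lebesgue. \<xi> \<in> fourier_support \<psi> \<longrightarrow> M \<xi> = exp (- (\<i> * complex_of_real (\<beta> * \<xi>)))"
  shows "translation \<beta> \<psi> \<in> closed_span (range (\<lambda>l. affine_system \<psi> 0 l))"
proof -
  let ?\<psi> = "fourier \<psi>"
  obtain w where w [measurable]: "w \<in> borel_measurable borel" and \<psi>w: "AE \<xi> in lebesgue. ?\<psi> \<xi> = w \<xi>"
    using complex_borel_representative[OF L2_measurable[OF fourier_L2[OF \<psi>]]] by blast
  define \<mu> where "\<mu> = density lborel (\<lambda>\<xi>. ennreal ((cmod (w \<xi>))\<^sup>2))"
  have cis: "cis \<in> borel_measurable borel"
    by (intro borel_measurable_continuous_onI continuous_intros)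
  have \<phi> [measurable]: "(\<lambda>\<xi>. cis (- \<xi>)) \<in> borel_measurable borel"
    by (intro measurable_compose[OF _ cis]) measurable
  \<comment> \<open>The minus sign makes z^l equal to e^{-i l xi}, the multiplier of the shift by
    l.\<close>
  define \<nu> where "\<nu> = distr \<mu> borel (\<lambda>\<xi>. cis (- \<xi>))"
  have sets_\<mu> [measurable_cong, simp]: "sets \<mu> = sets borel" by (simp add: \<mu>_def)
  have sp [simp]: "space \<mu> = UNIV" by (simp add: \<mu>_def)
  have transfer: "(\<integral>\<^sup>+z. ennreal ((cmod (G z))\<^sup>2) \<partial>\<nu>)
      = (\<integral>\<^sup>+\<xi>. ennreal ((cmod (G (cis (- \<xi>)) * ?\<psi> \<xi>))\<^sup>2) \<partial>lebesgue)"
    if G [measurable]: "G \<in> borel_measurable borel" for G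
  proof -
    have "(\<integral>\<^sup>+z. ennreal ((cmod (G z))\<^sup>2) \<partial>\<nu>)
        = (\<integral>\<^sup>+\<xi>. ennreal ((cmod (w \<xi>))\<^sup>2) * ennreal ((cmod (G (cis (- \<xi>))))\<^sup>2) \<partial>lborel)"
      unfolding \<nu>_def by (subst nn_integral_distr) (auto simp: \<mu>_def nn_integral_density)
    also have "\<dots> = (\<integral>\<^sup>+\<xi>. ennreal ((cmod (w \<xi>))\<^sup>2) * ennreal ((cmod (G (cis (- \<xi>))))\<^sup>2) \<partial>lebesgue)"
      by (simp add: nn_integral_completion)
    also have "\<dots> = (\<integral>\<^sup>+\<xi>. ennreal ((cmod (G (cis (- \<xi>)) * ?\<psi> \<xi>))\<^sup>2) \<partial>lebesgue)"
    proof (intro nn_integral_cong_AE)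
      show "AE \<xi> in lebesgue. ennreal ((cmod (w \<xi>))\<^sup>2) * ennreal ((cmod (G (cis (- \<xi>))))\<^sup>2)
          = ennreal ((cmod (G (cis (- \<xi>)) * ?\<psi> \<xi>))\<^sup>2)"
        using \<psi>w by eventually_elim (simp add: norm_mult power_mult_distrib ennreal_mult' mult.commute)
    qed
    finally show ?thesis .
  qed
  have "emeasure \<nu> (space \<nu>) = (\<integral>\<^sup>+z. ennreal ((cmod 1)\<^sup>2) \<partial>\<nu>)" by simp
  also have "\<dots> < \<infinity>"
    using transfer[of "\<lambda>_. 1"] fourier_L2[OF \<psi>] by (simp add: L2_iff_nn_integral)
  finally interpret finite_measure \<nu> by (intro finite_measureI) simp
  interpret circle_measure \<nu>
  proof unfold_locales
    show "sets \<nu> = sets borel" by (simp add: \<nu>_def)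
    show "AE z in \<nu>. cmod z = 1" unfolding \<nu>_def by (subst AE_distr_iff) auto
  qed
  define f where "f z = M (- Arg z)" for z
  have f [measurable]: "f \<in> borel_measurable borel" unfolding f_def by measurable
  have f_cis: "f (cis (- \<xi>)) = M \<xi>" for \<xi>
  proof -
    \<comment> \<open>\<open>Arg\<close> recovers -\<xi> up to a multiple of 2 pi, which the
      periodicity of M absorbs.\<close>
    obtain k where k: "- \<xi> - of_int k * (2 * pi) = Arg (cis (- \<xi>))"
      using Arg_exp_diff_2pi[of "\<i> * complex_of_real (- \<xi>)"] by (auto simp: cis_conv_exp)
    have "- Arg (cis (- \<xi>)) = \<xi> + 2 * pi * of_int k"
      unfolding k[symmetric] by (simp add: algebra_simps)
    then show ?thesis unfolding f_def by (simp only: periodic_int[of M, OF per])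
  qed
  have "(\<integral>\<^sup>+z. ennreal ((cmod (f z))\<^sup>2) \<partial>\<nu>) \<le> (\<integral>\<^sup>+z. ennreal (C\<^sup>2) \<partial>\<nu>)"
    by (intro nn_integral_mono ennreal_leI power_mono) (auto simp: f_def bound)
  then have f_fin: "(\<integral>\<^sup>+z. ennreal ((cmod (f z))\<^sup>2) \<partial>\<nu>) < \<infinity>"
    using constant_finite[of "C\<^sup>2"] by (rule order_le_less_trans)
  show ?thesis
  proof (rule closed_spanI)
    show "range (\<lambda>l. affine_system \<psi> 0 l) \<subseteq> L2"
      by (auto simp: affine_system_eq dil_0 L2_translation \<psi>)
    show "translation \<beta> \<psi> \<in> L2" by (rule L2_translation[OF \<psi>])
    fix e :: real assume e: "e > 0"
    then have "e\<^sup>2 > 0" by simp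
    then obtain L a where L: "finite L" "(\<integral>\<^sup>+z. ennreal ((cmod (f z - laurent L a z))\<^sup>2) \<partial>\<nu>) < ennreal (e\<^sup>2)"
      using laurent_dense[OF f f_fin] by blast
    let ?s = "\<lambda>x. \<Sum>l\<in>L. a l * translation (of_int l) \<psi> x"
    let ?d = "\<lambda>\<xi>. (exp (- (\<i> * complex_of_real (\<beta> * \<xi>))) - exp_sum L a of_int \<xi>) * ?\<psi> \<xi>"
    have dL2: "?d \<in> L2"
    proof (rule L2_mult_bounded[OF fourier_L2[OF \<psi>]])
      show "cmod (exp (- (\<i> * complex_of_real (\<beta> * \<xi>))) - exp_sum L a of_int \<xi>) \<le> 1 + (\<Sum>l\<in>L. cmod (a l))" for \<xi>
        using norm_triangle_ineq4[of "exp (- (\<i> * complex_of_real (\<beta> * \<xi>)))" "exp_sum L a of_int \<xi>"]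
          exp_sum_bound[of L a of_int \<xi>] by (simp add: norm_exp_eq_Re)
      note borel_measurable_exp_sum[measurable]
      have "(\<lambda>\<xi>. exp (- (\<i> * complex_of_real (\<beta> * \<xi>))) - exp_sum L a of_int \<xi>) \<in> borel_measurable borel"
        by measurable
      then show "(\<lambda>\<xi>. exp (- (\<i> * complex_of_real (\<beta> * \<xi>))) - exp_sum L a of_int \<xi>) \<in> borel_measurable lebesgue"
        by (intro measurable_completion) simp
    qed
    have lau: "laurent L a (cis (- \<xi>)) = exp_sum L a of_int \<xi>" for \<xi>
      unfolding laurent_def exp_sum_def Complex.cis_power_int by (simp add: cis_conv_exp)
    have "ennreal ((L2_norm ?d)\<^sup>2) = (\<integral>\<^sup>+\<xi>. ennreal ((cmod (?d \<xi>))\<^sup>2) \<partial>lebesgue)"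
      by (rule L2_nn_norm[OF dL2, symmetric])
    also have "\<dots> = (\<integral>\<^sup>+\<xi>. ennreal ((cmod ((M \<xi> - exp_sum L a of_int \<xi>) * ?\<psi> \<xi>))\<^sup>2) \<partial>lebesgue)"
    proof (intro nn_integral_cong_AE)
      show "AE \<xi> in lebesgue. ennreal ((cmod (?d \<xi>))\<^sup>2)
          = ennreal ((cmod ((M \<xi> - exp_sum L a of_int \<xi>) * ?\<psi> \<xi>))\<^sup>2)"
        using eq by eventually_elim (auto simp: fourier_support_def)
    qed
    also have "\<dots> = (\<integral>\<^sup>+z. ennreal ((cmod (f z - laurent L a z))\<^sup>2) \<partial>\<nu>)"
      by (subst transfer) (simp_all add: f_cis lau)
    also note L(2)
    finally have "L2_norm ?d < e"
      using e L2_norm_nonneg[of ?d] by (simp add: ennreal_less_iff power_less_imp_less_base)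
    then have "L2_norm (\<lambda>x. translation \<beta> \<psi> x - ?s x) < e"
      by (simp only: L2_norm_shift_approx[OF \<psi> L(1)])
    then show "\<exists>s\<in>cfun.span (range (\<lambda>l. affine_system \<psi> 0 l)). L2_norm (\<lambda>x. translation \<beta> \<psi> x - s x) < e"
      using shifts_in_span by (rule bexI)
  qed
qed

text \<open>Off a null set, two support points that differ by 2 pi K have K divisible by q = 2^n.
  Since e^{-i \<beta> xi} has period 2 pi q, its values at congruent points are then consistent, and
  a 2 pi-periodic M can be assembled.\<close>

lemma not_self_similar_shift_invariant:
  fixes n :: nat and m :: int
  assumes \<psi>: "\<psi> \<in> L2"
    and nss: "\<And>K::int. \<not> 2 ^ n dvd K \<Longrightarrow> \<not> partially_self_similar (fourier_support \<psi>) (2 * pi * of_int K)"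
  shows "translation (of_int m / 2 ^ n) \<psi> \<in> closed_span (range (\<lambda>l. affine_system \<psi> 0 l))"
proof -
  let ?E = "fourier_support \<psi>"
  define q :: nat where "q = 2 ^ n"
  define \<beta> :: real where "\<beta> = of_int m / 2 ^ n"
  have E: "?E \<in> sets lebesgue" by (rule fourier_support_measurable[OF \<psi>])
  \<comment> \<open>The largest candidate for the set F in partial self-similarity; for forbidden K
    it must be null.\<close>
  define A where "A K = ?E \<inter> {\<xi>. \<xi> + 2 * pi * of_int K \<in> ?E}" for K :: int
  have A_null: "A K \<in> null_sets lebesgue" if K: "\<not> 2 ^ n dvd K" for K
  proof -
    have "A K \<in> sets lebesgue" unfolding A_def by (intro sets.Int E sets_lebesgue_shift)
    moreover have "emeasure lebesgue (A K) = 0"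
      using nss[OF K] \<open>A K \<in> sets lebesgue\<close> unfolding partially_self_similar_def A_def by blast
    ultimately show ?thesis by auto
  qed
  define N where "N = (\<Union>K\<in>{K. \<not> 2 ^ n dvd K}. A K)"
  have N: "N \<in> null_sets lebesgue" unfolding N_def by (intro null_sets_UN' A_null) auto
  \<comment> \<open>Passage to a Borel subset S of full measure, because the multiplier has to be
    Borel.\<close>
  then have "?E - N \<in> sets (completion lborel)" using E by auto
  then obtain S Z Z' where Z: "?E - N = S \<union> Z" "Z \<subseteq> Z'" "Z' \<in> null_sets lborel" "S \<in> sets lborel"
    by (rule sets_completionE)
  have S [measurable]: "S \<in> sets borel" using Z(4) by simp
  have SE: "\<xi> \<in> ?E" "\<xi> \<notin> N" if "\<xi> \<in> S" for \<xi> using that Z(1) by auto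
  have AE_S: "AE \<xi> in lebesgue. \<xi> \<in> ?E \<longrightarrow> \<xi> \<in> S"
    using AE_completion[OF AE_not_in[OF Z(3)]] AE_not_in[OF N]
    by eventually_elim (use Z(1,2) in blast)
  \<comment> \<open>Saturation of S under translation by 2 pi q, so that the cut-off exponential
    \<open>g\<close> keeps the period 2 pi q.\<close>
  define P where "P = (\<Union>k::int. {\<xi>. \<xi> + 2 * pi * of_nat q * of_int k \<in> S})"
  have P [measurable]: "P \<in> sets borel"
    unfolding P_def
  proof (intro sets.countable_UN'' countableI_type)
    fix k :: int
    have "(\<lambda>\<xi>. \<xi> + 2 * pi * of_nat q * of_int k) \<in> borel_measurable borel" by measurable
    from measurable_sets[OF this S] show "{\<xi>. \<xi> + 2 * pi * of_nat q * of_int k \<in> S} \<in> sets borel"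
      by (simp add: vimage_def)
  qed
  define g where "g \<xi> = (if \<xi> \<in> P then exp (- (\<i> * complex_of_real (\<beta> * \<xi>))) else 0)" for \<xi>
  have g [measurable]: "g \<in> borel_measurable borel" unfolding g_def by measurable
  have g_le: "cmod (g \<xi>) \<le> 1" for \<xi> by (simp add: g_def norm_exp_eq_Re)
  have P_per: "\<xi> + 2 * pi * of_nat q \<in> P \<longleftrightarrow> \<xi> \<in> P" for \<xi>
  proof -
    have "\<xi> + 2 * pi * of_nat q + 2 * pi * of_nat q * of_int k = \<xi> + 2 * pi * of_nat q * of_int (k + 1)"
      "\<xi> + 2 * pi * of_nat q * of_int k = \<xi> + 2 * pi * of_nat q + 2 * pi * of_nat q * of_int (k - 1)" for k :: int
      by (simp_all add: algebra_simps)
    then show ?thesis unfolding P_def UN_iff mem_Collect_eq by (metis UNIV_I)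
  qed
  have g_per: "g (\<xi> + 2 * pi * of_nat q) = g \<xi>" for \<xi>
  proof -
    \<comment> \<open>The increment is 2 pi m because \<beta> q = m; its odd shape matches
      \<open>exp_minus_periodic\<close> with l = 1 at the point 0.\<close>
    have "\<beta> * (\<xi> + 2 * pi * of_nat q) = \<beta> * \<xi> + of_int 1 * (0 + 2 * pi * of_int m)"
      by (simp add: \<beta>_def q_def field_simps)
    then have "exp (- (\<i> * complex_of_real (\<beta> * (\<xi> + 2 * pi * of_nat q))))
        = exp (- (\<i> * complex_of_real (\<beta> * \<xi>))) * exp (- (\<i> * complex_of_real (of_int 1 * (0 + 2 * pi * of_int m))))"
      by (simp only: exp_add[symmetric] of_real_add) (simp add: algebra_simps)
    also have "\<dots> = exp (- (\<i> * complex_of_real (\<beta> * \<xi>)))"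
      by (simp only: exp_minus_periodic) simp
    finally show ?thesis unfolding g_def P_per by simp
  qed
  define M where "M \<xi> = (\<Sum>j<q. g (\<xi> + 2 * pi * of_nat j))" for \<xi>
  have q: "q > 0" by (simp add: q_def)
  have "translation \<beta> \<psi> \<in> closed_span (range (\<lambda>l. affine_system \<psi> 0 l))"
  proof (rule periodic_multiplier_shift_invariant[OF \<psi>])
    show "M \<in> borel_measurable borel" unfolding M_def by measurable
    show "M (\<xi> + 2 * pi) = M \<xi>" for \<xi>
    proof -
      let ?h = "\<lambda>j. g (\<xi> + 2 * pi * of_nat j)"
      have "M (\<xi> + 2 * pi) = (\<Sum>j<q. ?h (Suc j))"
        unfolding M_def by (simp add: algebra_simps)
      \<comment> \<open>A shift by 2 pi trades the term j = 0 for j = q, and these agree by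
        \<open>g_per\<close>.\<close>
      also have "\<dots> = (\<Sum>j<q. ?h j) + ?h q - ?h 0"
        using sum.lessThan_Suc[of ?h q] sum.lessThan_Suc_shift[of ?h q] by (simp add: algebra_simps)
      also have "\<dots> = M \<xi>" by (simp add: M_def g_per)
      finally show ?thesis .
    qed
    show "cmod (M \<xi>) \<le> of_nat q" for \<xi>
      unfolding M_def using sum_norm_bound[of "{..<q}" "\<lambda>j. g (\<xi> + 2 * pi * of_nat j)" 1] g_le by simp
    show "AE \<xi> in lebesgue. \<xi> \<in> ?E \<longrightarrow> M \<xi> = exp (- (\<i> * complex_of_real (\<beta> * \<xi>)))"
      using AE_S
    proof eventually_elim
      case (elim \<xi>)
      show ?case
      proof
        assume "\<xi> \<in> ?E"
        then have \<xi>: "\<xi> \<in> S" using elim by blast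
        have "\<xi> + 2 * pi * of_nat q * of_int 0 \<in> S" using \<xi> by simp
        then have "\<xi> \<in> P" unfolding P_def by blast
        then have g0: "g (\<xi> + 2 * pi * of_nat 0) = exp (- (\<i> * complex_of_real (\<beta> * \<xi>)))" by (simp add: g_def)
        \<comment> \<open>A further nonzero term with 0 < j < q would give a support point at
          distance 2 pi (j + q k), and j + q k is not divisible by q; then \<xi> would lie in
          N.\<close>
        have "g (\<xi> + 2 * pi * of_nat j) = 0" if j: "j \<in> {..<q} - {0}" for j
        proof -
          have "\<xi> + 2 * pi * of_nat j \<notin> P"
          proof
            assume "\<xi> + 2 * pi * of_nat j \<in> P"
            then obtain k :: int where k: "\<xi> + 2 * pi * of_nat j + 2 * pi * of_nat q * of_int k \<in> S"
              unfolding P_def by blast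
            define K where "K = int j + int q * k"
            have "\<xi> + 2 * pi * of_int K \<in> S" using k by (simp add: K_def algebra_simps)
            then have "\<xi> \<in> A K" using SE(1) \<xi> unfolding A_def by blast
            moreover have "\<not> 2 ^ n dvd K"
            proof
              assume "2 ^ n dvd K"
              then have "int q dvd K" by (simp add: q_def)
              then have "int q dvd int j" by (simp add: K_def dvd_add_left_iff)
              then have "q dvd j" by simp
              then show False using j by (auto dest: dvd_imp_le)
            qed
            ultimately have "\<xi> \<in> N" unfolding N_def by blast
            then show False using SE(2)[OF \<xi>] by blast
          qed
          then show ?thesis by (simp add: g_def)
        qed
        then have "M \<xi> = (\<Sum>j\<in>{0}. g (\<xi> + 2 * pi * of_nat j))"
          unfolding M_def using q by (intro sum.mono_neutral_right) auto
        then show "M \<xi> = exp (- (\<i> * complex_of_real (\<beta> * \<xi>)))" using g0 by simp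
      qed
    qed
  qed
  then show ?thesis by (simp only: \<beta>_def)
qed

text \<open>The 2-adic valuation of K is the exponent i < n; K = 0 is excluded on both
  sides.\<close>

lemma not_dvd_power_two_iff: "\<not> 2 ^ n dvd (K::int) \<longleftrightarrow> (\<exists>i<n. \<exists>j. odd j \<and> K = j * 2 ^ i)"
proof
  show "\<exists>i<n. \<exists>j. odd j \<and> K = j * 2 ^ i" if "\<not> 2 ^ n dvd K"
    using that
  proof (induction n arbitrary: K)
    case (Suc n)
    show ?case
    proof (cases "odd K")
      case True
      then show ?thesis by (intro exI[of _ 0]) auto
    next
      case False
      then obtain K' where K': "K = 2 * K'" by blast
      then have "\<not> 2 ^ n dvd K'" using Suc.prems by simp
      then obtain i j where "i < n" "odd j" "K' = j * 2 ^ i" using Suc.IH by blast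
      then show ?thesis by (intro exI[of _ "Suc i"]) (auto simp: K')
    qed
  qed simp
  show "\<not> 2 ^ n dvd K" if K: "\<exists>i<n. \<exists>j. odd j \<and> K = j * 2 ^ i"
  proof
    assume dvd: "2 ^ n dvd K"
    obtain i j where ij: "i < n" "odd j" "K = j * 2 ^ i" using K by blast
    have "2 ^ Suc i dvd K" using ij(1) dvd by (meson Suc_leI dvd_trans le_imp_power_dvd)
    then show False using ij by simp
  qed
qed

text \<open>One factor 2 is spent on writing the number as a multiple of 2 pi, whence the exponent k
  - 1 and the assumption k >= 1.\<close>

lemma odd_multiple_iff:
  assumes "k \<ge> 1"
  shows "odd_multiple (2 ^ k * pi) \<alpha> \<longleftrightarrow> (\<exists>j. odd j \<and> \<alpha> = 2 * pi * of_int (j * 2 ^ (k - 1)))"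
proof -
  obtain i where "k = Suc i" using assms by (cases k) auto
  then show ?thesis unfolding odd_multiple_def by (auto simp: mult_ac)
qed

lemma no_odd_multiple_iff:
  "(\<forall>k\<in>{1..n}. \<forall>\<alpha>. odd_multiple (2 ^ k * pi) \<alpha> \<longrightarrow> \<not> P \<alpha>)
    \<longleftrightarrow> (\<forall>K::int. \<not> 2 ^ n dvd K \<longrightarrow> \<not> P (2 * pi * of_int K))"
proof (intro iffI ballI allI impI)
  fix K :: int
  assume *: "\<forall>k\<in>{1..n}. \<forall>\<alpha>. odd_multiple (2 ^ k * pi) \<alpha> \<longrightarrow> \<not> P \<alpha>" and "\<not> 2 ^ n dvd K"
  then obtain i j where ij: "i < n" "odd j" "K = j * 2 ^ i" using not_dvd_power_two_iff by blast
  then have "odd_multiple (2 ^ Suc i * pi) (2 * pi * of_int K)"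
    by (subst odd_multiple_iff) (auto intro!: exI[of _ j])
  moreover have "Suc i \<in> {1..n}" using ij(1) by simp
  ultimately show "\<not> P (2 * pi * of_int K)" using * by blast
next
  fix k \<alpha>
  assume *: "\<forall>K::int. \<not> 2 ^ n dvd K \<longrightarrow> \<not> P (2 * pi * of_int K)"
    and k: "k \<in> {1..n}" and "odd_multiple (2 ^ k * pi) \<alpha>"
  then obtain j where j: "odd j" "\<alpha> = 2 * pi * of_int (j * 2 ^ (k - 1))"
    using odd_multiple_iff[of k \<alpha>] by auto
  moreover have "k - 1 < n" using k by auto
  then have "\<not> 2 ^ n dvd j * 2 ^ (k - 1)" using j(1) not_dvd_power_two_iff by blast
  ultimately show "\<not> P \<alpha>" using * by blast
qed

theorem wavelet_class_L_iff:
  assumes "wavelet \<psi>"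
  shows "\<psi> \<in> wavelet_class_L n \<longleftrightarrow>
    (\<forall>k\<in>{1..n}. \<forall>\<alpha>. odd_multiple (2 ^ k * pi) \<alpha> \<longrightarrow> \<not> partially_self_similar (fourier_support \<psi>) \<alpha>)"
proof -
  have \<psi>: "\<psi> \<in> L2" by (rule wavelet_L2[OF assms])
  have "\<psi> \<in> wavelet_class_L n \<longleftrightarrow>
      (\<forall>m::int. translation (of_int m / 2 ^ n) \<psi> \<in> closed_span (range (\<lambda>l. affine_system \<psi> 0 l)))"
    using core_space_invariant_iff[OF assms] assms by (simp add: wavelet_class_L_def)
  also have "\<dots> \<longleftrightarrow> (\<forall>K::int. \<not> 2 ^ n dvd K \<longrightarrow> \<not> partially_self_similar (fourier_support \<psi>) (2 * pi * of_int K))"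
  proof
    assume "\<forall>K::int. \<not> 2 ^ n dvd K \<longrightarrow> \<not> partially_self_similar (fourier_support \<psi>) (2 * pi * of_int K)"
    then show "\<forall>m::int. translation (of_int m / 2 ^ n) \<psi> \<in> closed_span (range (\<lambda>l. affine_system \<psi> 0 l))"
      using not_self_similar_shift_invariant[OF \<psi>] by blast
  next
    assume shift: "\<forall>m::int. translation (of_int m / 2 ^ n) \<psi> \<in> closed_span (range (\<lambda>l. affine_system \<psi> 0 l))"
    show "\<forall>K::int. \<not> 2 ^ n dvd K \<longrightarrow> \<not> partially_self_similar (fourier_support \<psi>) (2 * pi * of_int K)"
    proof (intro allI impI)
      fix K :: int assume K: "\<not> 2 ^ n dvd K"
      \<comment> \<open>The single translation with m = 1 already detects every K not divisible by
        2^n, since K / 2^n is then no integer.\<close>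
      have "of_int 1 / 2 ^ n * real_of_int K \<notin> \<int>"
      proof
        assume "of_int 1 / 2 ^ n * real_of_int K \<in> \<int>"
        then obtain i :: int where "of_int 1 / 2 ^ n * real_of_int K = of_int i" by (elim Ints_cases)
        then have "real_of_int K = of_int (2 ^ n * i)" by (simp add: field_simps)
        then have "K = 2 ^ n * i" by (simp only: of_int_eq_iff)
        then show False using K by simp
      qed
      then show "\<not> partially_self_similar (fourier_support \<psi>) (2 * pi * of_int K)"
        by (rule shift_invariant_not_self_similar[OF \<psi> shift[rule_format]])
    qed
  qed
  also have "\<dots> \<longleftrightarrow> (\<forall>k\<in>{1..n}. \<forall>\<alpha>. odd_multiple (2 ^ k * pi) \<alpha> \<longrightarrow>
      \<not> partially_self_similar (fourier_support \<psi>) \<alpha>)"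
    by (rule no_odd_multiple_iff[symmetric])
  finally show ?thesis .
qed

theorem corollary12:
  fixes n :: nat
  shows "wavelet_class_M n =
    {\<psi>. wavelet \<psi> \<and>
         (\<forall>k \<in> {1..n}. \<forall>\<alpha>. odd_multiple (2 ^ k * pi) \<alpha> \<longrightarrow>
            \<not> partially_self_similar (fourier_support \<psi>) \<alpha>) \<and>
         (\<exists>\<alpha>. odd_multiple (2 ^ (n + 1) * pi) \<alpha> \<and>
            partially_self_similar (fourier_support \<psi>) \<alpha>)}"
proof -
  \<comment> \<open>Passing from n to n + 1 adds only the condition for k = n + 1, whose failure is
    the existential clause.\<close>
  have "{1..Suc n} = insert (n + 1) {1..n}" by auto
  then have "\<psi> \<in> wavelet_class_L (Suc n) \<longleftrightarrow> \<psi> \<in> wavelet_class_L n \<and>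
      (\<forall>\<alpha>. odd_multiple (2 ^ (n + 1) * pi) \<alpha> \<longrightarrow> \<not> partially_self_similar (fourier_support \<psi>) \<alpha>)"
    if "wavelet \<psi>" for \<psi>
    unfolding wavelet_class_L_iff[OF that] by (simp only: ball_simps) blast
  moreover have "\<psi> \<in> wavelet_class_L n \<Longrightarrow> wavelet \<psi>" for \<psi>
    by (simp add: wavelet_class_L_def)
  ultimately show ?thesis
    unfolding wavelet_class_M_def using wavelet_class_L_iff by blast
qed

end
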